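(* Let $T=T_0+1$. Suppose (autoregressive model) that for each $i=1,\dots,N$, $$Y^N_{iT}(x)=\sum_{t=1}^{T_0}\langle\beta_t(x,\cdot),Y^N_{it}\rangle_{\mathcal H}+\varepsilon_{iT}(x),\qquad x\in\mathcal X,$$ where $\beta_t\in L^2(\mathcal X\times\mathcal X,\mu\otimes\mu)$, $t=1,\dots,T_0$, are coefficient functions, and $\varepsilon_{1T},\dots,\varepsilon_{NT}$ are independent, mean-zero $\mathcal H$-valued random elements with $\|\varepsilon_{iT}\|_{\mathcal H}\le\sigma$ almost surely for a constant $\sigma>0$. The pre-treatment outcomes $Y_{it}$ ($t\le T_0$) are treated as fixed, and $\hat\gamma=(\hat\gamma_2,\dots,\hat\gamma_N)\in\mathbb R^{N-1}$ is a fixed (non-random) weight vector with $\sum_{i=2}^N\hat\gamma_i=1$. Let $\hat\nu^N_{1T}$ be the generic weighting estimator built from $\hat\gamma$. Then for any $\delta>0$, with probability at least $1-2e^{-\delta^2/2}$, $$d(\nu^N_{1T},\hat\nu^N_{1T})\le\sqrt{\sum_{t=1}^{T_0}\|\beta_t\|^2_{\mathcal H\times\mathcal H}}\sqrt{\sum_{t=1}^{T_0}\Big\|Y_{1t}-\sum_{i=2}^N\hat\gamma_iY_{it}\Big\|_{\mathcal H}^2}+\delta\sigma(1+\|\hat\gamma\|_2).$$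
   Context: Let $(\mathcal X,\mathcal A,\mu)$ be either a compact interval $\mathcal I\subset\mathbb R$ with Lebesgue measure or the finite set $\{1,\dots,d\}$ with counting measure, and let $\mathcal H=L^2(\mathcal X,\mathcal A,\mu)$ (so $\mathcal H=L^2(\mathcal I)$ or $\mathcal H=\mathbb R^d$), with inner product $\langle f,g\rangle_{\mathcal H}=\int_{\mathcal X}fg\,d\mu$ and norm $\|\cdot\|_{\mathcal H}$. $(\mathcal M,d)$ is a metric space and $\Psi:\mathcal M\to\mathcal H$ is an isometry, $d(a,b)=\|\Psi(a)-\Psi(b)\|_{\mathcal H}$; its image $\mathcal Y=\Psi(\mathcal M)$ is nonempty, closed and convex in $\mathcal H$. Panel setting: units $i=1,\dots,N$, periods $t=1,\dots,T$, $1\le T_0<T$; transformed control potential outcomes $Y^N_{it}\in\mathcal Y$ and observed outcomes $Y_{it}\in\mathcal Y$ with $Y_{it}=Y^N_{it}$ whenever $i\ge2$ or $t\le T_0$; the counterfactual of interest is $\nu^N_{1T}=\Psi^{-1}(Y^N_{1T})$. Generic weighting estimator: given weights $\hat\gamma\in\mathbb R^{N-1}$ with $\sum_{i=2}^N\hat\gamma_i=1$ not depending on the post-treatment outcomes, set $\hat Y^N_{1T}=\sum_{i=2}^N\hat\gamma_iY_{iT}$, $\tilde Y^N_{1T}=\arg\min_{y\in\mathcal Y}\|y-\hat Y^N_{1T}\|_{\mathcal H}$ (the metric projection onto $\mathcal Y$), and $\hat\nu^N_{1T}=\Psi^{-1}(\tilde Y^N_{1T})$. For $\beta\in L^2(\mathcal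 X\times\mathcal X)$, $\|\beta\|_{\mathcal H\times\mathcal H}=\big(\int_{\mathcal X}\int_{\mathcal X}\beta(x,y)^2\,d\mu(x)d\mu(y)\big)^{1/2}$. *)

theory Defs
  imports "HOL-Probability.Probability"
begin

definition admissible_base :: "real measure \<Rightarrow> bool" where
  "admissible_base M \<longleftrightarrow>
     (\<exists>a b. a < b \<and> M = restrict_space lborel {a..b}) \<or>
     (\<exists>d::nat. 1 \<le> d \<and> M = count_space (real ` {1..d}))"

definition L2 :: "'a measure \<Rightarrow> ('a \<Rightarrow> real) set" where
  "L2 M = {f. f \<in> borel_measurable M \<and> integrable M (\<lambda>x. (f x)\<^sup>2)}"

definition Hinner :: "'a measure \<Rightarrow> ('a \<Rightarrow> real) \<Rightarrow> ('a \<Rightarrow> real) \<Rightarrow> real" where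
  "Hinner M f g = (\<integral>x. f x * g x \<partial>M)"

definition Hnorm :: "'a measure \<Rightarrow> ('a \<Rightarrow> real) \<Rightarrow> real" where
  "Hnorm M f = sqrt (\<integral>x. (f x)\<^sup>2 \<partial>M)"

definition HSnorm :: "'a measure \<Rightarrow> ('a \<Rightarrow> 'a \<Rightarrow> real) \<Rightarrow> real" where
  "HSnorm M \<beta> = sqrt (\<integral>z. (\<beta> (fst z) (snd z))\<^sup>2 \<partial>(M \<Otimes>\<^sub>M M))"

definition L2_kernel :: "'a measure \<Rightarrow> ('a \<Rightarrow> 'a \<Rightarrow> real) \<Rightarrow> bool" where
  "L2_kernel M \<beta> \<longleftrightarrow> (\<lambda>z. \<beta> (fst z) (snd z)) \<in> borel_measurable (M \<Otimes>\<^sub>M M) \<and>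
     integrable (M \<Otimes>\<^sub>M M) (\<lambda>z. (\<beta> (fst z) (snd z))\<^sup>2)"

text \<open>Borel sigma-algebra of H (for separable H it coincides with the sigma-algebra generated
  by the continuous linear functionals f |-> <f,g>).\<close>
definition Hborel :: "'a measure \<Rightarrow> ('a \<Rightarrow> real) measure" where
  "Hborel M = sigma UNIV
     {(\<lambda>f. Hinner M f g) -` B | g B. g \<in> L2 M \<and> B \<in> sets borel}"

definition H_convex :: "'a measure \<Rightarrow> ('a \<Rightarrow> real) set \<Rightarrow> bool" where
  "H_convex M S \<longleftrightarrow> (\<forall>f\<in>S. \<forall>g\<in>S. \<forall>u::real. 0 \<le> u \<and> u \<le> 1 \<longrightarrow>
      (\<exists>h\<in>S. AE x in M. h x = u * f x + (1 - u) * g x))"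

definition H_closed :: "'a measure \<Rightarrow> ('a \<Rightarrow> real) set \<Rightarrow> bool" where
  "H_closed M S \<longleftrightarrow> (\<forall>F f. (\<forall>n. F n \<in> S) \<longrightarrow> f \<in> L2 M \<longrightarrow>
      (\<lambda>n. Hnorm M (\<lambda>x. F n x - f x)) \<longlonglongrightarrow> 0 \<longrightarrow>
      (\<exists>h\<in>S. AE x in M. h x = f x))"

end

theory Submission
  imports Defs
begin

text \<open>The estimator's target lies in the convex set \<open>range \<Psi>\<close>, so projecting onto that set does
  not increase its distance to the weighted average. By the autoregressive model, the difference
  between the target and the weighted average is the image of the pre-treatment discrepancies
  under Hilbert--Schmidt operators plus the noise \<open>\<epsilon> 1 - (\<Sum>i=2..N. \<gamma> i * \<epsilon> i)\<close>. The first part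
  is bounded by Cauchy--Schwarz. The noise is bounded by Pinelis' form of Hoeffding's inequality
  in Hilbert space: \<open>cosh \<parallel>S + X\<parallel>\<close> has expectation at most \<open>cosh \<parallel>S\<parallel> * cosh c\<close> if
  \<open>X\<close> has mean zero and norm at most \<open>c\<close>, because \<open>cosh (sqrt u)\<close> is increasing and convex in \<open>u\<close>.
  This is shown for finitely many coordinates and transferred to \<open>L\<^sup>2\<close> along finite orthonormal
  families with asymptotically dense spans, which also give the measurability of the norm.\<close>

section \<open>Hoeffding's method for random vectors\<close>

text \<open>Convexity of x^k on the half-line. It is applied to the terms of the power series of
  cosh (sqrt u), with squares in the roles of \<open>p\<close> and \<open>q\<close>.\<close>

lemma power_convex_combination_le:
  fixes p q t :: real
  assumes "0 \<le> p" "0 \<le> q" "0 \<le> t" "t \<le> 1"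
  shows "(t * p + (1 - t) * q) ^ k \<le> t * p ^ k + (1 - t) * q ^ k"
proof -
  have "convex_on {0::real..} (\<lambda>x. x ^ k)"
  proof (cases "even k")
    case True
    then show ?thesis
      by (rule convex_on_subset[OF convex_power_even]) auto
  next
    case False
    then show ?thesis by (rule convex_power_odd)
  qed
  from convex_onD[OF this, of t q p] assms show ?thesis
    by (simp add: algebra_simps)
qed

text \<open>The function \<open>u \<mapsto> cosh (sqrt u)\<close> has a power series with nonnegative coefficients, so it is
  increasing and convex; the right-hand side is its chord over the interval from \<open>(a - c)\<^sup>2\<close> to
  \<open>(a + c)\<^sup>2\<close>, evaluated at \<open>a\<^sup>2 + c\<^sup>2 + 2 * s\<close>. For \<open>a * c = 0\<close> the quotient is \<open>0\<close>.\<close>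
lemma cosh_le_chord:
  fixes a c s v :: real
  assumes "0 \<le> a" "0 \<le> c" "\<bar>s\<bar> \<le> a * c" "0 \<le> v" "v\<^sup>2 \<le> a\<^sup>2 + c\<^sup>2 + 2 * s"
  shows "cosh v \<le> cosh a * cosh c + s * (sinh a * sinh c / (a * c))"
\<comment> \<open>If \<open>a * c = 0\<close>, the interval of the chord shrinks to a point and
  \<open>s = 0\<close> is forced. Then v \<le> a + c suffices, because sinh a * sinh c vanishes as
  well.\<close>
proof (cases "a * c = 0")
  case True
  then have "s = 0" using assms by auto
  with True assms have "v\<^sup>2 \<le> (a + c)\<^sup>2" by (auto simp: power2_sum)
  then have "v \<le> a + c" using assms by (meson add_nonneg_nonneg power2_le_imp_le)
  then have "cosh v \<le> cosh (a + c)" using assms by (simp add: cosh_real_nonneg_le_iff)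
  then show ?thesis using True \<open>s = 0\<close> by (auto simp: cosh_add)
next
  case False
  then have ac: "0 < a * c" using assms by (simp add: order_less_le)
  \<comment> \<open>\<open>t\<close> is the barycentric coordinate of a^2 + c^2 + 2 * s between (a -
    c)^2 at t = 0 and (a + c)^2 at t = 1.\<close>
  define t where "t = (1 + s / (a * c)) / 2"
  have st: "s = (2 * t - 1) * (a * c)" using False by (simp add: t_def field_simps)
  have t: "0 \<le> t" "t \<le> 1"
    using assms(3) ac divide_right_mono[of s "a * c" "a * c"] divide_right_mono[of "- (a * c)" s "a * c"]
    by (auto simp: t_def abs_le_iff split: if_splits)
  have v2: "v\<^sup>2 \<le> t * (a + c)\<^sup>2 + (1 - t) * (a - c)\<^sup>2"
    using assms(5) unfolding st by (simp add: power2_eq_square algebra_simps)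
  \<comment> \<open>Even powers are all that the cosh series contains. They are treated as powers of
    squares, since a - c may be negative while its square lies on the half-line.\<close>
  have pow_le: "v ^ n \<le> t * (a + c) ^ n + (1 - t) * (a - c) ^ n" if "even n" for n
  proof -
    obtain k where n: "n = 2 * k" using \<open>even n\<close> by auto
    have "(v\<^sup>2) ^ k \<le> (t * (a + c)\<^sup>2 + (1 - t) * (a - c)\<^sup>2) ^ k"
      using v2 by (intro power_mono) auto
    also have "\<dots> \<le> t * ((a + c)\<^sup>2) ^ k + (1 - t) * ((a - c)\<^sup>2) ^ k"
      using t by (intro power_convex_combination_le) auto
    finally show ?thesis by (simp add: n power_mult)
  qed
  have "(if even n then v ^ n /\<^sub>R fact n else 0) \<le>
      t * (if even n then (a + c) ^ n /\<^sub>R fact n else 0) +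
      (1 - t) * (if even n then (a - c) ^ n /\<^sub>R fact n else 0)" for n
    using mult_left_mono[OF pow_le[of n], of "inverse (fact n)"]
    by (simp add: distrib_left mult.left_commute)
  then have "cosh v \<le> t * cosh (a + c) + (1 - t) * cosh (a - c)"
    by (intro sums_le[OF _ cosh_converges sums_add[OF sums_mult[OF cosh_converges] sums_mult[OF cosh_converges]]])
  also have "\<dots> = cosh a * cosh c + (2 * t - 1) * (sinh a * sinh c)"
    by (simp add: cosh_add cosh_diff algebra_simps)
  also have "(2 * t - 1) = s / (a * c)" using False by (simp add: st)
  finally show ?thesis by simp
qed

text \<open>The two power series are compared term by term, using 2^k * k! \<le> (2k)!.\<close>

lemma cosh_le_exp_half_square: "cosh x \<le> exp (x\<^sup>2 / 2)" for x :: real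
proof -
  have fact: "2 ^ k * fact k \<le> (fact (2 * k) :: real)" for k
  proof (induction k)
    case (Suc k)
    have "2 ^ Suc k * fact (Suc k) = (2 * real k + 2) * 1 * (2 ^ k * fact k)"
      by (simp add: algebra_simps)
    also have "\<dots> \<le> (2 * real k + 2) * (2 * real k + 1) * fact (2 * k)"
      using Suc by (intro mult_mono) auto
    also have "\<dots> = fact (2 * Suc k)" by (simp add: algebra_simps)
    finally show ?case .
  qed simp
  have term_le: "x ^ (2 * k) /\<^sub>R fact (2 * k) \<le> (x\<^sup>2 / 2) ^ k /\<^sub>R fact k" for k
  proof -
    have "y ^ k /\<^sub>R fact (2 * k) \<le> (y / 2) ^ k /\<^sub>R fact k" if "0 \<le> y" for y :: real
    proof -
      have "y ^ k / fact (2 * k) \<le> y ^ k / (2 ^ k * fact k)"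
        using fact[of k] that by (intro divide_left_mono) auto
      moreover have "(y / 2) ^ k /\<^sub>R fact k = y ^ k / (2 ^ k * fact k)"
        by (simp add: power_divide field_simps)
      ultimately show ?thesis by (simp add: field_simps)
    qed
    from this[of "x\<^sup>2"] show ?thesis by (simp only: power_mult zero_le_power2)
  qed
  \<comment> \<open>The odd terms of the cosh series are zero, so summation along the even indices
    gives the same value.\<close>
  have "(\<lambda>k. if even (2 * k) then x ^ (2 * k) /\<^sub>R fact (2 * k) else 0) sums cosh x"
    by (subst sums_mono_reindex[where f = "\<lambda>n. if even n then x ^ n /\<^sub>R fact n else 0"])
       (auto simp: strict_mono_def cosh_converges elim!: evenE)
  then have "(\<lambda>k. x ^ (2 * k) /\<^sub>R fact (2 * k)) sums cosh x" by simp
  from sums_le[OF term_le this exp_converges] show ?thesis .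
qed

lemma L2_set_power2: "(L2_set f K)\<^sup>2 = (\<Sum>k\<in>K. (f k)\<^sup>2)"
  by (simp add: L2_set_def sum_nonneg)

lemma borel_measurable_L2_set [measurable (raw)]:
  assumes "\<And>k. k \<in> K \<Longrightarrow> (\<lambda>\<omega>. f \<omega> k) \<in> borel_measurable N"
  shows "(\<lambda>\<omega>. L2_set (f \<omega>) K) \<in> borel_measurable N"
  unfolding L2_set_def using assms by measurable

lemma borel_measurable_cosh_sinh [measurable]:
  "(cosh :: real \<Rightarrow> real) \<in> borel_measurable borel" "(sinh :: real \<Rightarrow> real) \<in> borel_measurable borel"
  by (auto intro!: borel_measurable_continuous_onI continuous_intros)

text \<open>Hoeffding's method in Euclidean spaces, after Pinelis: conditionally on the partial sum, the
  term of the chord bound that is linear in the next summand has mean zero.\<close>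
lemma (in prob_space) expectation_cosh_norm_sum_le:
  fixes X :: "'i \<Rightarrow> 'a \<Rightarrow> 'k \<Rightarrow> real"
  assumes "finite I" and K: "finite K"
    and "indep_vars (\<lambda>_. PiM K (\<lambda>_. borel)) X I"
    and "\<And>i k. i \<in> I \<Longrightarrow> k \<in> K \<Longrightarrow> expectation (\<lambda>\<omega>. X i \<omega> k) = 0"
    and "\<And>i. i \<in> I \<Longrightarrow> 0 \<le> c i"
    and "\<And>i. i \<in> I \<Longrightarrow> AE \<omega> in M. L2_set (X i \<omega>) K \<le> c i"
  shows "expectation (\<lambda>\<omega>. cosh (L2_set (\<lambda>k. \<Sum>i\<in>I. X i \<omega> k) K)) \<le> (\<Prod>i\<in>I. cosh (c i))"
  using assms(1,3-)
proof (induction I rule: finite_induct)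
  case empty
  then show ?case by (simp add: L2_set_def prob_space)
next
  case (insert i I)
  note indep = insert.prems(1) and c = insert.prems(3) and bdd = insert.prems(4)
  have IH: "expectation (\<lambda>\<omega>. cosh (L2_set (\<lambda>k. \<Sum>i\<in>I. X i \<omega> k) K)) \<le> (\<Prod>i\<in>I. cosh (c i))"
    using insert.prems by (intro insert.IH indep_vars_subset[OF indep]) auto
  have rv: "random_variable (PiM K (\<lambda>_. borel)) (X j)" if "j \<in> insert i I" for j
    using indep that unfolding indep_vars_def by blast
  have meas: "(\<lambda>\<omega>. X j \<omega> k) \<in> borel_measurable M" if "j \<in> insert i I" "k \<in> K" for j k
    by (rule measurable_compose[OF rv[OF that(1)] measurable_component_singleton[OF that(2)]])
  \<comment> \<open>\<open>S\<close> is the partial sum without the summand \<open>i\<close>,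
    \<open>a\<close> is its norm, and \<open>h (a \<omega>)\<close> is the coefficient of the inner
    product in the chord bound. \<open>B\<close> bounds \<open>a\<close> almost surely.\<close>
  define S where "S \<omega> k = (\<Sum>j\<in>I. X j \<omega> k)" for \<omega> k
  define a where "a \<omega> = L2_set (S \<omega>) K" for \<omega>
  define h where "h r = sinh r * sinh (c i) / (r * c i)" for r
  define B where "B = sum c I"
  have S_meas [measurable]: "(\<lambda>\<omega>. S \<omega> k) \<in> borel_measurable M" if "k \<in> K" for k
    unfolding S_def using meas that by measurable
  have a_meas [measurable]: "a \<in> borel_measurable M" unfolding a_def by measurable
  have h_meas [measurable]: "h \<in> borel_measurable borel" unfolding h_def by measurable
  have c0: "0 \<le> c i" and B0: "0 \<le> B" using c by (auto simp: B_def intro!: sum_nonneg)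
  have a0: "0 \<le> a \<omega>" for \<omega> by (simp add: a_def)
  have S_le: "\<bar>S \<omega> k\<bar> \<le> a \<omega>" if "k \<in> K" for \<omega> k
    using member_le_L2_set[OF K that, of "\<lambda>k. \<bar>S \<omega> k\<bar>"] by (simp add: a_def L2_set_def)
  have a_le: "AE \<omega> in M. a \<omega> \<le> B"
  proof -
    have "AE \<omega> in M. \<forall>j\<in>I. L2_set (X j \<omega>) K \<le> c j"
      using insert.hyps bdd by (intro AE_finite_allI) auto
    then show ?thesis
    proof eventually_elim
      case (elim \<omega>)
      have "L2_set (\<lambda>k. \<Sum>j\<in>J. X j \<omega> k) K \<le> (\<Sum>j\<in>J. L2_set (X j \<omega>) K)" if "finite J" for J
        using that
      proof (induction J)
        case (insert j J)
        then show ?case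
          using L2_set_triangle_ineq[of "X j \<omega>" "\<lambda>k. \<Sum>j\<in>J. X j \<omega> k" K] by simp
      qed (simp add: L2_set_def)
      from this[OF insert.hyps(1)] have "a \<omega> \<le> (\<Sum>j\<in>I. L2_set (X j \<omega>) K)"
        by (simp add: a_def S_def[abs_def])
      also have "\<dots> \<le> B" unfolding B_def using elim by (intro sum_mono) auto
      finally show ?case .
    qed
  qed
  have Xk_le: "AE \<omega> in M. \<bar>X i \<omega> k\<bar> \<le> c i" if "k \<in> K" for k
    using bdd[OF insertI1]
  proof eventually_elim
    case (elim \<omega>)
    then show ?case
      using member_le_L2_set[OF K that, of "\<lambda>k. \<bar>X i \<omega> k\<bar>"] by (simp add: L2_set_def)
  qed
  have int_X: "integrable M (\<lambda>\<omega>. X i \<omega> k)" if "k \<in> K" for k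
    using Xk_le[OF that] meas[of i k] that by (intro integrable_const_bound[where B = "c i"]) auto
  have int_cosh: "integrable M (\<lambda>\<omega>. cosh (a \<omega>))"
    using a_le by (intro integrable_const_bound[where B = "cosh B"])
      (auto elim!: eventually_mono simp: cosh_real_nonneg_le_iff a0 B0)
  \<comment> \<open>The factor \<open>S \<omega> k\<close>, at most \<open>a \<omega>\<close> in
    absolute value, cancels the \<open>a \<omega>\<close> in the denominator of
    \<open>h (a \<omega>)\<close>; what remains is controlled by sinh. If \<open>a \<omega>\<close>
    or \<open>c i\<close> is zero, division by zero gives 0.\<close>
  have int_Sh: "integrable M (\<lambda>\<omega>. S \<omega> k * h (a \<omega>))" if k: "k \<in> K" for k
  proof (rule integrable_const_bound[where B = "sinh B * (sinh (c i) / c i)"])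
    show "AE \<omega> in M. norm (S \<omega> k * h (a \<omega>)) \<le> sinh B * (sinh (c i) / c i)"
      using a_le
    proof eventually_elim
      case (elim \<omega>)
      have "norm (S \<omega> k * h (a \<omega>)) \<le> a \<omega> * \<bar>h (a \<omega>)\<bar>"
        using S_le[OF k] by (auto simp: abs_mult intro!: mult_right_mono)
      also have "\<dots> \<le> sinh (a \<omega>) * (sinh (c i) / c i)"
        using a0[of \<omega>] c0 by (auto simp: h_def abs_mult field_simps)
      also have "\<dots> \<le> sinh B * (sinh (c i) / c i)"
        using elim c0 by (intro mult_right_mono) auto
      finally show ?case .
    qed
  qed (use k in measurable)
  \<comment> \<open>The two variables are functions of disjoint blocks of the independent family,
    namely {i} and \<open>I\<close>.\<close>
  have indep_k: "indep_var borel (\<lambda>\<omega>. X i \<omega> k) borel (\<lambda>\<omega>. S \<omega> k * h (a \<omega>))" if k: "k \<in> K" for k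
  proof -
    let ?N = "PiM K (\<lambda>_. borel) :: ('k \<Rightarrow> real) measure"
    have comp [measurable]: "(\<lambda>f. f j l) \<in> borel_measurable (PiM J (\<lambda>_. ?N))" if "j \<in> J" "l \<in> K" for j l J
      by (rule measurable_compose[OF measurable_component_singleton[OF that(1)] measurable_component_singleton[OF that(2)]])
    have 1: "indep_var (PiM {i} (\<lambda>_. ?N)) (\<lambda>\<omega>. restrict (\<lambda>i. X i \<omega>) {i})
        (PiM I (\<lambda>_. ?N)) (\<lambda>\<omega>. restrict (\<lambda>i. X i \<omega>) I)"
      using insert.hyps by (intro indep_var_restrict[OF indep]) auto
    have "indep_var borel ((\<lambda>f. f i k) \<circ> (\<lambda>\<omega>. restrict (\<lambda>i. X i \<omega>) {i}))
        borel ((\<lambda>f. (\<Sum>j\<in>I. f j k) * h (L2_set (\<lambda>k. \<Sum>j\<in>I. f j k) K)) \<circ> (\<lambda>\<omega>. restrict (\<lambda>i. X i \<omega>) I))"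
      by (rule indep_var_compose[OF 1]) (use k in measurable)
    then show ?thesis
      by (simp add: o_def S_def[abs_def] a_def)
  qed
  \<comment> \<open>Independence factors the expectation, and the factor coming from
    \<open>X i\<close> has mean zero.\<close>
  have zero: "expectation (\<lambda>\<omega>. X i \<omega> k * (S \<omega> k * h (a \<omega>))) = 0"
    and int_XSh: "integrable M (\<lambda>\<omega>. X i \<omega> k * (S \<omega> k * h (a \<omega>)))" if k: "k \<in> K" for k
    using indep_var_lebesgue_integral[OF indep_k[OF k] int_X[OF k] int_Sh[OF k]]
      indep_var_integrable[OF indep_k[OF k] int_X[OF k] int_Sh[OF k]] insert.prems(2)[of i k] k
    by auto
  \<comment> \<open>The squared norm of S + X i is expanded; its cross term \<open>s\<close> is at
    most a * c i in absolute value by Cauchy--Schwarz, as the chord bound requires.\<close>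
  have ae: "AE \<omega> in M. cosh (L2_set (\<lambda>k. \<Sum>j\<in>insert i I. X j \<omega> k) K)
      \<le> cosh (a \<omega>) * cosh (c i) + (\<Sum>k\<in>K. X i \<omega> k * (S \<omega> k * h (a \<omega>)))"
    using bdd[of i, OF insertI1]
  proof eventually_elim
    case (elim \<omega>)
    define s where "s = (\<Sum>k\<in>K. S \<omega> k * X i \<omega> k)"
    have "\<bar>s\<bar> \<le> (\<Sum>k\<in>K. \<bar>S \<omega> k\<bar> * \<bar>X i \<omega> k\<bar>)"
      unfolding s_def by (rule order_trans[OF sum_abs]) (simp add: abs_mult)
    also have "\<dots> \<le> a \<omega> * L2_set (X i \<omega>) K" unfolding a_def by (rule L2_set_mult_ineq)
    also have "\<dots> \<le> a \<omega> * c i" using elim a0 by (intro mult_left_mono)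
    finally have s: "\<bar>s\<bar> \<le> a \<omega> * c i" .
    have "(L2_set (\<lambda>k. S \<omega> k + X i \<omega> k) K)\<^sup>2 = (a \<omega>)\<^sup>2 + (L2_set (X i \<omega>) K)\<^sup>2 + 2 * s"
      unfolding a_def L2_set_power2 s_def
      by (simp add: power2_sum sum.distrib sum_distrib_left mult_ac)
    also have "\<dots> \<le> (a \<omega>)\<^sup>2 + (c i)\<^sup>2 + 2 * s"
      using elim by (simp add: power_mono)
    finally have "cosh (L2_set (\<lambda>k. S \<omega> k + X i \<omega> k) K) \<le> cosh (a \<omega>) * cosh (c i) + s * h (a \<omega>)"
      unfolding h_def by (intro cosh_le_chord s a0 c0) auto
    moreover have "(\<lambda>k. S \<omega> k + X i \<omega> k) = (\<lambda>k. \<Sum>j\<in>insert i I. X j \<omega> k)"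
      using insert.hyps by (auto simp: S_def)
    moreover have "s * h (a \<omega>) = (\<Sum>k\<in>K. X i \<omega> k * (S \<omega> k * h (a \<omega>)))"
      unfolding s_def sum_distrib_right by (rule sum.cong) auto
    ultimately show ?case by simp
  qed
  have int_R: "integrable M (\<lambda>\<omega>. cosh (a \<omega>) * cosh (c i) + (\<Sum>k\<in>K. X i \<omega> k * (S \<omega> k * h (a \<omega>))))"
    using int_cosh int_XSh by auto
  have "expectation (\<lambda>\<omega>. cosh (L2_set (\<lambda>k. \<Sum>j\<in>insert i I. X j \<omega> k) K))
      \<le> expectation (\<lambda>\<omega>. cosh (a \<omega>) * cosh (c i) + (\<Sum>k\<in>K. X i \<omega> k * (S \<omega> k * h (a \<omega>))))"
  \<comment> \<open>This form of monotonicity asks for nonnegativity of the majorant in place of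
    integrability of the left-hand side.\<close>
  proof (rule integral_mono_AE'[OF int_R ae])
    show "AE \<omega> in M. 0 \<le> cosh (a \<omega>) * cosh (c i) + (\<Sum>k\<in>K. X i \<omega> k * (S \<omega> k * h (a \<omega>)))"
      using ae by eventually_elim (meson cosh_real_nonneg order_trans)
  qed
  also have "\<dots> = expectation (\<lambda>\<omega>. cosh (a \<omega>)) * cosh (c i)"
    using int_cosh int_XSh zero by (simp add: integral_sum)
  also have "\<dots> \<le> (\<Prod>j\<in>I. cosh (c j)) * cosh (c i)"
    using IH by (intro mult_right_mono) (auto simp: a_def S_def[abs_def])
  finally show ?case using insert.hyps by (simp add: mult.commute)
qed

section \<open>The space of square-integrable functions\<close>

lemma L2_measurable: "f \<in> L2 M \<Longrightarrow> f \<in> borel_measurable M"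
  and L2_integrable_power2: "f \<in> L2 M \<Longrightarrow> integrable M (\<lambda>x. (f x)\<^sup>2)"
  by (auto simp: L2_def)

lemma L2_integrable_mult:
  assumes "f \<in> L2 M" "g \<in> L2 M"
  shows "integrable M (\<lambda>x. f x * g x)"
proof (rule Bochner_Integration.integrable_bound)
  show "integrable M (\<lambda>x. (f x)\<^sup>2 + (g x)\<^sup>2)"
    using assms by (auto simp: L2_def)
  show "AE x in M. norm (f x * g x) \<le> norm ((f x)\<^sup>2 + (g x)\<^sup>2)"
  proof (rule AE_I2)
    fix x
    have "0 \<le> (\<bar>f x\<bar> - \<bar>g x\<bar>)\<^sup>2" by simp
    then have "2 * (\<bar>f x\<bar> * \<bar>g x\<bar>) \<le> (f x)\<^sup>2 + (g x)\<^sup>2"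
      by (simp add: power2_diff)
    moreover have "0 \<le> \<bar>f x\<bar> * \<bar>g x\<bar>" by simp
    ultimately have "\<bar>f x\<bar> * \<bar>g x\<bar> \<le> (f x)\<^sup>2 + (g x)\<^sup>2" by linarith
    then show "norm (f x * g x) \<le> norm ((f x)\<^sup>2 + (g x)\<^sup>2)" by (simp add: abs_mult)
  qed
qed (use assms in \<open>auto simp: L2_def\<close>)

lemma L2_cmult: "f \<in> L2 M \<Longrightarrow> (\<lambda>x. u * f x) \<in> L2 M"
  by (auto simp: L2_def power_mult_distrib)

lemma L2_add:
  assumes "f \<in> L2 M" "g \<in> L2 M"
  shows "(\<lambda>x. f x + g x) \<in> L2 M"
  using assms L2_integrable_mult[OF assms]
  by (auto simp: L2_def power2_sum mult.assoc)

lemma L2_diff: "f \<in> L2 M \<Longrightarrow> g \<in> L2 M \<Longrightarrow> (\<lambda>x. f x - g x) \<in> L2 M"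
  using L2_add[of f M "\<lambda>x. (-1) * g x"] L2_cmult[of g M "-1"] by simp

lemma L2_zero: "(\<lambda>x. 0) \<in> L2 M"
  by (simp add: L2_def)

lemma L2_sum: "(\<And>i. i \<in> I \<Longrightarrow> f i \<in> L2 M) \<Longrightarrow> (\<lambda>x. \<Sum>i\<in>I. f i x) \<in> L2 M"
  by (induction I rule: infinite_finite_induct) (simp_all add: L2_add L2_zero)

section \<open>Hilbert space geometry: inner product, norm, orthonormal families, projection\<close>

lemma Hnorm_nonneg [simp]: "0 \<le> Hnorm M f"
  by (simp add: Hnorm_def)

lemma Hnorm_power2: "(Hnorm M f)\<^sup>2 = (\<integral>x. (f x)\<^sup>2 \<partial>M)"
  by (simp add: Hnorm_def)

lemma Hinner_self: "Hinner M f f = (Hnorm M f)\<^sup>2"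
  by (simp add: Hinner_def Hnorm_power2 flip: power2_eq_square)

lemma Hinner_commute: "Hinner M f g = Hinner M g f"
  by (simp add: Hinner_def mult.commute)

lemma Hinner_cmult_left: "Hinner M (\<lambda>x. u * f x) g = u * Hinner M f g"
  by (simp add: Hinner_def mult.assoc)

lemma Hinner_sum_left:
  "(\<And>i. i \<in> I \<Longrightarrow> f i \<in> L2 M) \<Longrightarrow> g \<in> L2 M \<Longrightarrow>
    Hinner M (\<lambda>x. \<Sum>i\<in>I. f i x) g = (\<Sum>i\<in>I. Hinner M (f i) g)"
  by (simp add: Hinner_def sum_distrib_right L2_integrable_mult Bochner_Integration.integral_sum)

lemma Hnorm_cong_AE:
  assumes "f \<in> borel_measurable M" "g \<in> borel_measurable M" "AE x in M. f x = g x"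
  shows "Hnorm M f = Hnorm M g"
proof -
  have "(\<integral>x. (f x)\<^sup>2 \<partial>M) = (\<integral>x. (g x)\<^sup>2 \<partial>M)"
    using assms by (intro integral_cong_AE) (auto elim!: eventually_mono)
  then show ?thesis by (simp add: Hnorm_def)
qed

text \<open>The scalar \<open>u\<close> is kept because the quadratic in \<open>u\<close> has
  several uses: all u for Cauchy--Schwarz, u = 1 for the triangle inequality, u = -1 for distances,
  and small positive u for the projection.\<close>

lemma Hnorm_add_power2:
  assumes "f \<in> L2 M" "g \<in> L2 M"
  shows "(Hnorm M (\<lambda>x. f x + u * g x))\<^sup>2 = (Hnorm M f)\<^sup>2 + 2 * u * Hinner M f g + u\<^sup>2 * (Hnorm M g)\<^sup>2"
proof -
  have "(\<integral>x. (f x + u * g x)\<^sup>2 \<partial>M) = (\<integral>x. (f x)\<^sup>2 + 2 * u * (f x * g x) + u\<^sup>2 * (g x)\<^sup>2 \<partial>M)"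
    by (intro Bochner_Integration.integral_cong) (auto simp: power2_sum power_mult_distrib)
  also have "\<dots> = (\<integral>x. (f x)\<^sup>2 \<partial>M) + 2 * u * (\<integral>x. f x * g x \<partial>M) + u\<^sup>2 * (\<integral>x. (g x)\<^sup>2 \<partial>M)"
    using assms by (simp add: L2_integrable_mult L2_integrable_power2)
  finally show ?thesis by (simp add: Hnorm_power2 Hinner_def)
qed

lemma Hinner_Cauchy_Schwarz:
  assumes f: "f \<in> L2 M" and g: "g \<in> L2 M"
  shows "\<bar>Hinner M f g\<bar> \<le> Hnorm M f * Hnorm M g"
proof -
  let ?F = "(Hnorm M f)\<^sup>2" and ?G = "(Hnorm M g)\<^sup>2" and ?p = "Hinner M f g"
  have q: "0 \<le> ?F + 2 * u * ?p + u\<^sup>2 * ?G" for u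
    using Hnorm_add_power2[OF f g, of u] by (metis zero_le_power2)
  have "?p\<^sup>2 \<le> ?F * ?G"
  proof (cases "?G = 0")
    case True
    have "?p = 0"
    proof (rule ccontr)
      assume "?p \<noteq> 0"
      \<comment> \<open>With vanishing ?G the expression is affine in u; the chosen u gives it the
        value -1.\<close>
      then show False using q[of "- (?F + 1) / (2 * ?p)"] True by (simp add: field_simps)
    qed
    then show ?thesis by simp
  next
    case False
    then have G: "0 < ?G" by (simp add: order_less_le)
    \<comment> \<open>u = -p / G minimizes the quadratic; nonnegativity of the minimum is the
      claim.\<close>
    have "F + 2 * (- p / G) * p + (- p / G)\<^sup>2 * G = F - p\<^sup>2 / G" if "G \<noteq> 0" for F p G :: real
      using that by (simp add: power2_eq_square)
    from this[OF False, of ?F ?p] have "0 \<le> ?F - ?p\<^sup>2 / ?G"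
      using q[of "- ?p / ?G"] by simp
    then show ?thesis using G by (simp add: field_simps)
  qed
  then have "\<bar>?p\<bar>\<^sup>2 \<le> (Hnorm M f * Hnorm M g)\<^sup>2" by (simp add: power_mult_distrib)
  then show ?thesis by (rule power2_le_imp_le) simp
qed

lemma Hnorm_triangle:
  assumes "f \<in> L2 M" "g \<in> L2 M"
  shows "Hnorm M (\<lambda>x. f x + g x) \<le> Hnorm M f + Hnorm M g"
proof (rule power2_le_imp_le)
  show "(Hnorm M (\<lambda>x. f x + g x))\<^sup>2 \<le> (Hnorm M f + Hnorm M g)\<^sup>2"
    using Hnorm_add_power2[OF assms, of 1] Hinner_Cauchy_Schwarz[OF assms]
    by (simp add: power2_sum)
qed simp

lemma Hnorm_cmult: "Hnorm M (\<lambda>x. u * f x) = \<bar>u\<bar> * Hnorm M f"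
  by (simp add: Hnorm_def power_mult_distrib real_sqrt_mult)

lemma Hnorm_sum_le:
  "(\<And>i. i \<in> I \<Longrightarrow> f i \<in> L2 M) \<Longrightarrow> Hnorm M (\<lambda>x. \<Sum>i\<in>I. f i x) \<le> (\<Sum>i\<in>I. Hnorm M (f i))"
proof (induction I rule: infinite_finite_induct)
  case (insert i I)
  then show ?case
    using Hnorm_triangle[of "f i" M "\<lambda>x. \<Sum>i\<in>I. f i x"] by (simp add: L2_sum)
qed (simp_all add: Hnorm_def)

text \<open>Completing the square separates the squared distance from \<open>f\<close> to the span
  from the deviation of the coefficients \<open>a\<close> from the Fourier coefficients. Taking the
  latter for \<open>a\<close> gives Bessel's inequality; dropping the last sum bounds the distance
  to the span.\<close>

lemma Hnorm_diff_orthonormal_power2: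
  assumes f: "f \<in> L2 M" and K: "finite K" and g: "\<And>k. k \<in> K \<Longrightarrow> g k \<in> L2 M"
    and on: "\<And>k l. k \<in> K \<Longrightarrow> l \<in> K \<Longrightarrow> Hinner M (g k) (g l) = (if k = l then 1 else 0)"
  shows "(Hnorm M (\<lambda>x. f x - (\<Sum>k\<in>K. a k * g k x)))\<^sup>2 =
    (Hnorm M f)\<^sup>2 - (\<Sum>k\<in>K. (Hinner M f (g k))\<^sup>2) + (\<Sum>k\<in>K. (a k - Hinner M f (g k))\<^sup>2)"
proof -
  let ?q = "\<lambda>x. \<Sum>k\<in>K. a k * g k x"
  have q: "?q \<in> L2 M" using g by (intro L2_sum L2_cmult)
  have inner_q: "Hinner M ?q h = (\<Sum>k\<in>K. a k * Hinner M (g k) h)" if "h \<in> L2 M" for h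
    using g that by (subst Hinner_sum_left) (auto simp: L2_cmult Hinner_cmult_left)
  have "(Hnorm M ?q)\<^sup>2 = (\<Sum>k\<in>K. a k * Hinner M ?q (g k))"
    unfolding Hinner_self[symmetric] inner_q[OF q] by (simp add: Hinner_commute)
  also have "\<dots> = (\<Sum>k\<in>K. (a k)\<^sup>2)"
  proof (rule sum.cong[OF refl])
    fix k assume k: "k \<in> K"
    have "Hinner M ?q (g k) = (\<Sum>l\<in>K. a l * (if l = k then 1 else 0))"
      unfolding inner_q[OF g[OF k]] using k by (intro sum.cong) (auto simp: on)
    also have "\<dots> = a k" using k K by (simp add: if_distrib cong: if_cong)
    finally show "a k * Hinner M ?q (g k) = (a k)\<^sup>2" by (simp add: power2_eq_square)
  qed
  finally have "(Hnorm M ?q)\<^sup>2 = (\<Sum>k\<in>K. (a k)\<^sup>2)" .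
  moreover have "Hinner M f ?q = (\<Sum>k\<in>K. a k * Hinner M f (g k))"
    using inner_q[OF f] by (simp add: Hinner_commute[of M f])
  ultimately show ?thesis
    using Hnorm_add_power2[OF f q, of "-1"]
    by (simp add: power2_diff sum.distrib sum_subtractf sum_distrib_left sum_negf mult_ac)
qed

lemma Bessel_inequality:
  assumes "f \<in> L2 M" "finite K" "\<And>k. k \<in> K \<Longrightarrow> g k \<in> L2 M"
    and "\<And>k l. k \<in> K \<Longrightarrow> l \<in> K \<Longrightarrow> Hinner M (g k) (g l) = (if k = l then 1 else 0)"
  shows "L2_set (\<lambda>k. Hinner M f (g k)) K \<le> Hnorm M f"
proof -
  have "0 \<le> (Hnorm M (\<lambda>x. f x - (\<Sum>k\<in>K. Hinner M f (g k) * g k x)))\<^sup>2" by simp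
  also have "\<dots> = (Hnorm M f)\<^sup>2 - (\<Sum>k\<in>K. (Hinner M f (g k))\<^sup>2)"
    using Hnorm_diff_orthonormal_power2[OF assms, where a = "\<lambda>k. Hinner M f (g k)"] by simp
  finally show ?thesis by (simp add: L2_set_def real_le_lsqrt sum_nonneg)
qed

text \<open>The families for different n may be unrelated: neither nested spans nor a single
  orthonormal basis are demanded. Normalized step functions on finer and finer grids therefore
  qualify directly.\<close>

definition orthonormal_approximation :: "'a measure \<Rightarrow> (nat \<Rightarrow> 'k set) \<Rightarrow> (nat \<Rightarrow> 'k \<Rightarrow> 'a \<Rightarrow> real) \<Rightarrow> bool" where
  "orthonormal_approximation M K g \<longleftrightarrow>
     (\<forall>n. finite (K n)) \<and> (\<forall>n. \<forall>k\<in>K n. g n k \<in> L2 M) \<and>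
     (\<forall>n. \<forall>k\<in>K n. \<forall>l\<in>K n. Hinner M (g n k) (g n l) = (if k = l then 1 else 0)) \<and>
     (\<forall>f\<in>L2 M. \<forall>e>0. \<forall>\<^sub>F n in sequentially. \<exists>a. Hnorm M (\<lambda>x. f x - (\<Sum>k\<in>K n. a k * g n k x)) < e)"

text \<open>Bessel's inequality bounds the coordinate norm from above. From below, its defect is the
  distance to the span, which is at most the error of any approximating combination.\<close>

lemma orthonormal_approximation_tendsto:
  assumes oa: "orthonormal_approximation M K g" and f: "f \<in> L2 M"
  shows "(\<lambda>n. L2_set (\<lambda>k. Hinner M f (g n k)) (K n)) \<longlonglongrightarrow> Hnorm M f"
proof -
  have "(\<lambda>n. \<Sum>k\<in>K n. (Hinner M f (g n k))\<^sup>2) \<longlonglongrightarrow> (Hnorm M f)\<^sup>2"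
  proof (rule tendstoI)
    fix e :: real assume e: "0 < e"
    have "\<forall>\<^sub>F n in sequentially. \<exists>a. Hnorm M (\<lambda>x. f x - (\<Sum>k\<in>K n. a k * g n k x)) < sqrt e"
      using oa f e by (auto simp: orthonormal_approximation_def)
    then show "\<forall>\<^sub>F n in sequentially. dist (\<Sum>k\<in>K n. (Hinner M f (g n k))\<^sup>2) ((Hnorm M f)\<^sup>2) < e"
    proof eventually_elim
      case (elim n)
      then obtain a where a: "Hnorm M (\<lambda>x. f x - (\<Sum>k\<in>K n. a k * g n k x)) < sqrt e" by blast
      have Kn: "finite (K n)" "\<And>k. k \<in> K n \<Longrightarrow> g n k \<in> L2 M"
        "\<And>k l. k \<in> K n \<Longrightarrow> l \<in> K n \<Longrightarrow> Hinner M (g n k) (g n l) = (if k = l then 1 else 0)"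
        using oa by (auto simp: orthonormal_approximation_def)
      have "(Hnorm M (\<lambda>x. f x - (\<Sum>k\<in>K n. a k * g n k x)))\<^sup>2 < e"
        using a e by (metis Hnorm_nonneg power_strict_mono real_sqrt_pow2 less_imp_le pos2)
      moreover have "0 \<le> (\<Sum>k\<in>K n. (a k - Hinner M f (g n k))\<^sup>2)" by (simp add: sum_nonneg)
      ultimately have "(Hnorm M f)\<^sup>2 - (\<Sum>k\<in>K n. (Hinner M f (g n k))\<^sup>2) < e"
        using Hnorm_diff_orthonormal_power2[OF f Kn, where a = a] by simp
      moreover have "(\<Sum>k\<in>K n. (Hinner M f (g n k))\<^sup>2) \<le> (Hnorm M f)\<^sup>2"
        using power_mono[OF Bessel_inequality[OF f Kn] L2_set_nonneg, where n = 2]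
        by (simp add: L2_set_def sum_nonneg)
      ultimately show ?case by (simp add: dist_real_def)
    qed
  qed
  then have "(\<lambda>n. sqrt (\<Sum>k\<in>K n. (Hinner M f (g n k))\<^sup>2)) \<longlonglongrightarrow> sqrt ((Hnorm M f)\<^sup>2)"
    by (rule tendsto_real_sqrt)
  then show ?thesis by (simp add: L2_set_def)
qed

text \<open>Moving from the minimizer \<open>p\<close> towards \<open>y\<close> cannot decrease the
  distance to \<open>q\<close>, so the first-order term gives 0 \<le> <p - q, y - p>. Expanding the
  square of y - q = (p - q) + (y - p) then yields the claim.\<close>

lemma projection_nonexpansive:
  assumes S: "S \<subseteq> L2 M" "H_convex M S" and y: "y \<in> S" and p: "p \<in> S" and q: "q \<in> L2 M"
    and min: "\<And>z. z \<in> S \<Longrightarrow> Hnorm M (\<lambda>x. p x - q x) \<le> Hnorm M (\<lambda>x. z x - q x)"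
  shows "Hnorm M (\<lambda>x. y x - p x) \<le> Hnorm M (\<lambda>x. y x - q x)"
proof -
  define v where "v x = p x - q x" for x
  define w where "w x = y x - p x" for x
  have v: "v \<in> L2 M" and w: "w \<in> L2 M"
    using S y p q by (auto simp: v_def[abs_def] w_def[abs_def] intro!: L2_diff)
  have "0 \<le> 2 * Hinner M v w + u * (Hnorm M w)\<^sup>2" if u: "0 < u" "u \<le> 1" for u
  proof -
    \<comment> \<open>Convexity supplies the combination up to a null set only, so the norms are
      matched through equality almost everywhere.\<close>
    obtain h where h: "h \<in> S" "AE x in M. h x = u * y x + (1 - u) * p x"
      using S(2) y p u unfolding H_convex_def by (meson less_imp_le)
    have "Hnorm M (\<lambda>x. h x - q x) = Hnorm M (\<lambda>x. v x + u * w x)"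
    proof (rule Hnorm_cong_AE)
      show "AE x in M. h x - q x = v x + u * w x"
        using h(2) by eventually_elim (simp add: v_def w_def algebra_simps)
      show "(\<lambda>x. h x - q x) \<in> borel_measurable M"
        using h(1) q S by (intro L2_measurable L2_diff) auto
      show "(\<lambda>x. v x + u * w x) \<in> borel_measurable M"
        using v w by (intro L2_measurable L2_add L2_cmult)
    qed
    then have "Hnorm M v \<le> Hnorm M (\<lambda>x. v x + u * w x)"
      using min[OF h(1)] by (simp add: v_def[abs_def])
    then have "(Hnorm M v)\<^sup>2 \<le> (Hnorm M (\<lambda>x. v x + u * w x))\<^sup>2" by (simp add: power_mono)
    then have "0 \<le> u * (2 * Hinner M v w + u * (Hnorm M w)\<^sup>2)"
      using Hnorm_add_power2[OF v w, of u] by (simp add: power2_eq_square algebra_simps)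
    then show ?thesis using u by (simp add: zero_le_mult_iff)
  qed
  \<comment> \<open>The factor u has been divided out; letting u tend to 0 from the right leaves the
    sign of the inner product.\<close>
  then have "\<forall>\<^sub>F u in at_right 0. 0 \<le> 2 * Hinner M v w + u * (Hnorm M w)\<^sup>2"
    using eventually_at_right[of 0 "1::real"] by (auto intro!: exI[of _ 1])
  moreover have "((\<lambda>u. 2 * Hinner M v w + u * (Hnorm M w)\<^sup>2) \<longlongrightarrow> 2 * Hinner M v w + 0 * (Hnorm M w)\<^sup>2) (at_right 0)"
    by (intro tendsto_intros)
  ultimately have "0 \<le> 2 * Hinner M v w + 0 * (Hnorm M w)\<^sup>2"
    by (intro tendsto_lowerbound) auto
  then have "(Hnorm M w)\<^sup>2 \<le> (Hnorm M (\<lambda>x. v x + 1 * w x))\<^sup>2"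
    unfolding Hnorm_add_power2[OF v w] by simp
  then have "Hnorm M w \<le> Hnorm M (\<lambda>x. v x + 1 * w x)" by (rule power2_le_imp_le) simp
  then show ?thesis by (simp add: v_def w_def[abs_def])
qed

section \<open>Finite-dimensional approximation\<close>

lemma tendsto_Hnorm_zero:
  assumes [measurable]: "\<And>n. f n \<in> borel_measurable M" and w: "w \<in> L2 M"
    and lim: "AE x in M. (\<lambda>n. f n x) \<longlonglongrightarrow> 0" and le: "\<And>n. AE x in M. \<bar>f n x\<bar> \<le> w x"
  shows "(\<lambda>n. Hnorm M (f n)) \<longlonglongrightarrow> 0"
proof -
  have "(\<lambda>n. \<integral>x. (f n x)\<^sup>2 \<partial>M) \<longlonglongrightarrow> (\<integral>x. 0 \<partial>M)"
  proof (rule integral_dominated_convergence[where w = "\<lambda>x. (w x)\<^sup>2"])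
    show "AE x in M. (\<lambda>n. (f n x)\<^sup>2) \<longlonglongrightarrow> 0"
      using lim by eventually_elim (auto intro!: tendsto_eq_intros)
    show "AE x in M. norm ((f n x)\<^sup>2) \<le> (w x)\<^sup>2" for n
      using le[of n]
    proof eventually_elim
      case (elim x)
      then show ?case using power_mono[of "\<bar>f n x\<bar>" "w x" 2] by simp
    qed
  qed (use w in \<open>auto simp: L2_integrable_power2\<close>)
  then show ?thesis
    unfolding Hnorm_def using tendsto_real_sqrt by fastforce
qed

section \<open>Dense families: continuous functions, point indicators, step functions\<close>

lemma finite_measure_restrict_lborel: "finite_measure (restrict_space lborel {a..b::real})"
  by (intro finite_measureI) (auto simp: emeasure_restrict_space space_restrict_space emeasure_lborel_Icc_eq)

lemma L2_bounded:
  assumes "finite_measure M" "f \<in> borel_measurable M" "AE x in M. \<bar>f x\<bar> \<le> B"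
  shows "f \<in> L2 M"
proof -
  interpret finite_measure M by fact
  have "integrable M (\<lambda>x. (f x)\<^sup>2)"
  proof (rule integrable_const_bound[where B = "B\<^sup>2"])
    show "AE x in M. norm ((f x)\<^sup>2) \<le> B\<^sup>2"
      using assms(3)
    proof eventually_elim
      case (elim x)
      then show ?case using power_mono[of "\<bar>f x\<bar>" B 2] by simp
    qed
  qed (use assms in auto)
  with assms show ?thesis by (simp add: L2_def)
qed

lemma borel_measurable_restrict_lborel:
  assumes "continuous_on UNIV f"
  shows "(f :: real \<Rightarrow> real) \<in> borel_measurable (restrict_space lborel S)"
  using assms by (intro measurable_restrict_space1) (simp add: borel_measurable_continuous_onI)

text \<open>First \<open>f\<close> is truncated to a bounded function, then the truncation is
  approximated almost everywhere by bounded continuous functions. Dominated convergence controls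
  both errors, each by e / 2.\<close>

lemma continuous_functions_dense_L2:
  fixes a b e :: real
  defines "M \<equiv> restrict_space lborel {a..b}"
  assumes f: "f \<in> L2 M" and e: "0 < e"
  obtains \<phi> where "continuous_on UNIV \<phi>" "\<phi> \<in> L2 M" "Hnorm M (\<lambda>x. f x - \<phi> x) < e"
proof -
  interpret finite_measure M unfolding M_def by (rule finite_measure_restrict_lborel)
  have f_meas [measurable]: "f \<in> borel_measurable M" using f by (rule L2_measurable)
  define clip :: "nat \<Rightarrow> real \<Rightarrow> real" where "clip n y = max (- real n) (min (real n) y)" for n y
  have clip_bd: "\<bar>clip n y\<bar> \<le> real n" for n y by (auto simp: clip_def)
  have clip_meas [measurable]: "clip n \<in> borel_measurable borel" for n
    unfolding clip_def by measurable
  have "(\<lambda>n. Hnorm M (\<lambda>x. f x - clip n (f x))) \<longlonglongrightarrow> 0"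
  proof (rule tendsto_Hnorm_zero[where w = "\<lambda>x. \<bar>f x\<bar>"])
    show "(\<lambda>x. \<bar>f x\<bar>) \<in> L2 M" using f by (simp add: L2_def)
    show "AE x in M. (\<lambda>n. f x - clip n (f x)) \<longlonglongrightarrow> 0"
    proof (rule AE_I2)
      fix x
      have "\<forall>\<^sub>F n in sequentially. \<bar>f x\<bar> \<le> real n"
        using eventually_ge_at_top[of "nat \<lceil>\<bar>f x\<bar>\<rceil>"] by eventually_elim linarith
      then have "\<forall>\<^sub>F n in sequentially. f x - clip n (f x) = 0"
        by eventually_elim (auto simp: clip_def)
      then show "(\<lambda>n. f x - clip n (f x)) \<longlonglongrightarrow> 0" by (rule tendsto_eventually)
    qed
    show "AE x in M. \<bar>f x - clip n (f x)\<bar> \<le> \<bar>f x\<bar>" for n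
      by (auto simp: clip_def)
  qed measurable
  then have "\<forall>\<^sub>F n in sequentially. Hnorm M (\<lambda>x. f x - clip n (f x)) < e / 2"
    using e by (intro order_tendstoD) auto
  then obtain n where n: "Hnorm M (\<lambda>x. f x - clip n (f x)) < e / 2"
    by (auto simp: eventually_sequentially)
  \<comment> \<open>Extension by zero gives a measurable function on the whole line.\<close>
  have "(\<lambda>x. if x \<in> {a..b} then clip n (f x) else 0) \<in> borel_measurable lborel"
  proof -
    have "(\<lambda>x. clip n (f x)) \<in> borel_measurable (restrict_space lborel {a..b})"
      by (fold M_def) measurable
    then have "(\<lambda>x. indicator {a..b} x *\<^sub>R clip n (f x)) \<in> borel_measurable lborel"
      by (subst (asm) borel_measurable_restrict_space_iff) auto
    also have "(\<lambda>x. indicator {a..b} x *\<^sub>R clip n (f x)) = (\<lambda>x. if x \<in> {a..b} then clip n (f x) else 0)"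
      by (auto simp: indicator_def)
    finally show ?thesis .
  qed
  then have "(\<lambda>x. if x \<in> {a..b} then clip n (f x) else 0) \<in> borel_measurable lebesgue"
    by (rule measurable_completion)
  \<comment> \<open>\<open>measurable_on\<close> means being the limit of continuous functions off a
    negligible set; this supplies \<psi>.\<close>
  then have "(\<lambda>x. if x \<in> {a..b} then clip n (f x) else 0) measurable_on UNIV"
    by (rule lebesgue_measurable_imp_measurable_on) simp
  then obtain N \<psi> where N: "negligible N" and \<psi>: "\<And>m. continuous_on UNIV (\<psi> m)"
    and lim: "\<And>x. x \<notin> N \<Longrightarrow> (\<lambda>m. \<psi> m x) \<longlonglongrightarrow> (if x \<in> {a..b} then clip n (f x) else 0)"
    unfolding measurable_on_def by auto
  have AE_N: "AE x in lborel. x \<notin> N"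
    using AE_not_in[of N lebesgue] N by (simp only: negligible_iff_null_sets AE_completion_iff)
  \<comment> \<open>Clipping the approximants keeps them continuous and adds a constant majorant.
    The limit is unchanged, since it is already clipped.\<close>
  define \<phi> where "\<phi> m x = clip n (\<psi> m x)" for m x
  have \<phi>_cont: "continuous_on UNIV (\<phi> m)" for m
    unfolding \<phi>_def clip_def by (intro continuous_intros \<psi>)
  have \<phi>_meas [measurable]: "\<phi> m \<in> borel_measurable M" for m
    unfolding M_def by (rule borel_measurable_restrict_lborel[OF \<phi>_cont])
  have \<phi>_L2: "\<phi> m \<in> L2 M" for m
    by (rule L2_bounded[of _ _ "real n"]) (auto simp: finite_measure_axioms \<phi>_def clip_bd)
  have clip_L2: "(\<lambda>x. clip n (f x)) \<in> L2 M"
    by (rule L2_bounded[of _ _ "real n"]) (auto simp: finite_measure_axioms clip_bd)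
  have "(\<lambda>m. Hnorm M (\<lambda>x. clip n (f x) - \<phi> m x)) \<longlonglongrightarrow> 0"
  proof (rule tendsto_Hnorm_zero[where w = "\<lambda>x. 2 * real n"])
    show "(\<lambda>x. 2 * real n) \<in> L2 M" by (simp add: L2_def)
    show "AE x in M. (\<lambda>m. clip n (f x) - \<phi> m x) \<longlonglongrightarrow> 0"
      unfolding M_def
    proof (subst AE_restrict_space_iff, simp, use AE_N in eventually_elim, intro impI)
      fix x assume x: "x \<notin> N" "x \<in> {a..b}"
      then have "(\<lambda>m. \<psi> m x) \<longlonglongrightarrow> clip n (f x)" using lim[OF x(1)] by simp
      then have "(\<lambda>m. clip n (\<psi> m x)) \<longlonglongrightarrow> clip n (clip n (f x))"
        unfolding clip_def by (intro tendsto_intros)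
      then show "(\<lambda>m. clip n (f x) - \<phi> m x) \<longlonglongrightarrow> 0"
        by (intro tendsto_eq_intros) (auto simp: \<phi>_def clip_def)
    qed
    show "AE x in M. \<bar>clip n (f x) - \<phi> m x\<bar> \<le> 2 * real n" for m
    proof (rule AE_I2)
      fix x
      show "\<bar>clip n (f x) - \<phi> m x\<bar> \<le> 2 * real n"
        using clip_bd[of n "f x"] clip_bd[of n "\<psi> m x"] by (simp add: \<phi>_def)
    qed
  qed measurable
  then have "\<forall>\<^sub>F m in sequentially. Hnorm M (\<lambda>x. clip n (f x) - \<phi> m x) < e / 2"
    using e by (intro order_tendstoD) auto
  then obtain m where m: "Hnorm M (\<lambda>x. clip n (f x) - \<phi> m x) < e / 2"
    by (auto simp: eventually_sequentially)
  have "Hnorm M (\<lambda>x. (f x - clip n (f x)) + (clip n (f x) - \<phi> m x))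
      \<le> Hnorm M (\<lambda>x. f x - clip n (f x)) + Hnorm M (\<lambda>x. clip n (f x) - \<phi> m x)"
    using f clip_L2 \<phi>_L2 by (intro Hnorm_triangle L2_diff)
  with n m have "Hnorm M (\<lambda>x. f x - \<phi> m x) < e" by simp
  with that \<phi>_cont \<phi>_L2 show thesis by blast
qed

text \<open>Point indicators reproduce \<open>f\<close> exactly on \<open>A\<close>, with
  coefficients \<open>f (h k)\<close>, so the error is 0 for every n. The parametrization
  \<open>h\<close> permits natural numbers as indices of real points.\<close>

lemma orthonormal_approximation_count_space:
  assumes A: "finite A" and g: "inj_on h K" "h ` K = A"
  shows "orthonormal_approximation (count_space A) (\<lambda>_. K) (\<lambda>_ k. indicator {h k})"
proof -
  have K: "finite K" using assms finite_imageD by blast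
  have "\<exists>c. Hnorm (count_space A) (\<lambda>x. f x - (\<Sum>k\<in>K. c k * indicator {h k} x)) < e" if "0 < e" for f and e :: real
  proof (intro exI)
    have "f x - (\<Sum>k\<in>K. f (h k) * indicator {h k} x) = 0" if "x \<in> A" for x
    proof -
      obtain l where l: "l \<in> K" "x = h l" using g \<open>x \<in> A\<close> by auto
      have "(\<Sum>k\<in>K. f (h k) * indicator {h k} x) = (\<Sum>k\<in>K. if k = l then f x else 0)"
        using g(1) l by (intro sum.cong) (auto simp: indicator_def inj_on_eq_iff)
      then show ?thesis using l K by simp
    qed
    then show "Hnorm (count_space A) (\<lambda>x. f x - (\<Sum>k\<in>K. f (h k) * indicator {h k} x)) < e"
      using A \<open>0 < e\<close> by (simp add: Hnorm_def lebesgue_integral_count_space_finite)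
  qed
  moreover have "Hinner (count_space A) (indicator {h k}) (indicator {h l}) = (if k = l then 1 else 0)"
    if "k \<in> K" "l \<in> K" for k l
  proof -
    have "Hinner (count_space A) (indicator {h k}) (indicator {h l}) = (\<Sum>x\<in>A. if x = h k then (if k = l then 1 else 0) else 0)"
      unfolding Hinner_def lebesgue_integral_count_space_finite[OF A]
      using g(1) that by (intro sum.cong) (auto simp: indicator_def inj_on_eq_iff)
    then show ?thesis using A g that by auto
  qed
  ultimately show ?thesis
    using A K by (simp add: orthonormal_approximation_def L2_def integrable_count_space)
qed

text \<open>The functions are normalized indicators of n + 1 half-open cells of equal length. A
  continuous function is uniformly close to its step function of left-endpoint values, and
  continuous functions are dense.\<close>

lemma orthonormal_approximation_interval:
  fixes a b :: real
  assumes ab: "a < b"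
  defines "h \<equiv> \<lambda>n. (b - a) / real (Suc n)"
  shows "orthonormal_approximation (restrict_space lborel {a..b}) (\<lambda>n. {..n})
    (\<lambda>n j x. indicator {a + real j * h n ..< a + (real j + 1) * h n} x / sqrt (h n))"
proof -
  define M where "M = restrict_space lborel {a..b}"
  define C where "C n j = {a + real j * h n ..< a + (real j + 1) * h n}" for n j
  define g where "g n j x = indicator (C n j) x / sqrt (h n)" for n j x
  interpret finite_measure M unfolding M_def by (rule finite_measure_restrict_lborel)
  have h: "0 < h n" "real (Suc n) * h n = b - a" for n using ab by (auto simp: h_def)
  have C_sub: "C n j \<subseteq> {a..b}" if "j \<le> n" for n j
  proof -
    have "(real j + 1) * h n \<le> real (Suc n) * h n"
      using that h(1)[of n] by (intro mult_right_mono) auto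
    moreover have "0 \<le> real j * h n" using h(1)[of n] by simp
    ultimately show ?thesis using h(2)[of n] by (auto simp: C_def)
  qed
  \<comment> \<open>The cell index is a floor, which gives disjointness of the cells and locates the
    cell of a point.\<close>
  have C_iff: "x \<in> C n j \<longleftrightarrow> \<lfloor>(x - a) / h n\<rfloor> = int j" for x n j
    using h(1)[of n] by (auto simp: C_def floor_eq_iff field_simps)
  have [measurable]: "C n j \<in> sets borel" for n j by (simp add: C_def)
  have g_meas [measurable]: "g n j \<in> borel_measurable M" for n j
    unfolding M_def g_def[abs_def] by (rule measurable_restrict_space1) measurable
  have g_L2: "g n j \<in> L2 M" for n j
    using h(1)[of n] by (intro L2_bounded[of _ _ "1 / sqrt (h n)"] AE_I2)
      (auto simp: finite_measure_axioms g_def indicator_def)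
  have g_on: "Hinner M (g n j) (g n l) = (if j = l then 1 else 0)" if "j \<le> n" "l \<le> n" for n j l
  proof -
    have "indicator {a..b} x *\<^sub>R (g n j x * g n l x) = (if j = l then 1 else 0) * (indicator (C n j) x / h n)" for x
      using C_sub[OF that(1)] h(1)[of n] by (auto simp: g_def C_iff indicator_def)
    then have "Hinner M (g n j) (g n l) = (\<integral>x. (if j = l then 1 else 0) * (indicator (C n j) x / h n) \<partial>lborel)"
      by (simp add: Hinner_def M_def integral_restrict_space)
    also have "\<dots> = (if j = l then 1 else 0) * (measure lborel (C n j) / h n)"
      by simp
    also have "measure lborel (C n j) = h n"
      using h(1)[of n] by (simp add: C_def algebra_simps)
    finally show ?thesis using h(1)[of n] by simp
  qed
  have approx: "\<forall>\<^sub>F n in sequentially. \<exists>c. Hnorm M (\<lambda>x. f x - (\<Sum>j\<le>n. c j * g n j x)) < e"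
    if f: "f \<in> L2 M" and e: "0 < e" for f and e :: real
  proof -
    obtain \<phi> where \<phi>: "continuous_on UNIV \<phi>" "\<phi> \<in> L2 M" "Hnorm M (\<lambda>x. f x - \<phi> x) < e / 2"
      using continuous_functions_dense_L2[of f a b "e / 2"] f e unfolding M_def by auto
    \<comment> \<open>A uniform error \<eta> on an interval of length b - a has norm \<eta> * sqrt
      (b - a) = e / 2.\<close>
    define \<eta> where "\<eta> = e / 2 / sqrt (b - a)"
    have \<eta>: "0 < \<eta>" using e ab by (simp add: \<eta>_def)
    have "uniformly_continuous_on {a..b} \<phi>"
      using \<phi>(1) by (intro compact_uniformly_continuous) (auto intro: continuous_on_subset)
    then obtain d where d: "0 < d"
      and d_le: "\<And>x y. x \<in> {a..b} \<Longrightarrow> y \<in> {a..b} \<Longrightarrow> \<bar>x - y\<bar> < d \<Longrightarrow> \<bar>\<phi> x - \<phi> y\<bar> < \<eta>"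
      using \<eta> unfolding uniformly_continuous_on_def dist_real_def by metis
    have "(\<lambda>n. (b - a) * inverse (real (Suc n))) \<longlonglongrightarrow> (b - a) * 0"
      by (intro tendsto_intros LIMSEQ_inverse_real_of_nat)
    then have "\<forall>\<^sub>F n in sequentially. h n < d"
      using order_tendstoD(2)[of _ 0 _ d] d by (simp add: h_def divide_inverse)
    then show ?thesis
    proof eventually_elim
      case (elim n)
      \<comment> \<open>The factor sqrt (h n) undoes the normalization of \<open>g n j\<close>, so
        on each cell \<open>q\<close> is the value of \<phi> at the left endpoint.\<close>
      define q where "q x = (\<Sum>j\<le>n. (\<phi> (a + real j * h n) * sqrt (h n)) * g n j x)" for x
      have q_L2: "q \<in> L2 M"
        unfolding q_def[abs_def] by (intro L2_sum L2_cmult g_L2)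
      have close: "\<bar>\<phi> x - q x\<bar> \<le> \<eta>" if x: "x \<in> {a..<b}" for x
      proof -
        define j where "j = nat \<lfloor>(x - a) / h n\<rfloor>"
        have j: "\<lfloor>(x - a) / h n\<rfloor> = int j" using x h(1)[of n] by (simp add: j_def)
        have "(x - a) / h n < real (Suc n)"
          using x h[of n] by (simp add: pos_divide_less_eq)
        then have "j \<le> n" using j by linarith
        have "q x = (\<Sum>i\<le>n. if i = j then \<phi> (a + real j * h n) else 0)"
          unfolding q_def using h(1)[of n] j by (intro sum.cong) (auto simp: g_def C_iff indicator_def)
        then have q: "q x = \<phi> (a + real j * h n)" using \<open>j \<le> n\<close> by simp
        have xC: "x \<in> C n j" using j by (simp add: C_iff)
        then have "a + real j * h n \<in> C n j" using h(1)[of n] by (auto simp: C_def)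
        moreover have "\<bar>x - (a + real j * h n)\<bar> < d" using xC elim by (auto simp: C_def algebra_simps)
        ultimately show ?thesis
          using d_le[of x "a + real j * h n"] C_sub[OF \<open>j \<le> n\<close>] x unfolding q by fastforce
      qed
      have "(Hnorm M (\<lambda>x. \<phi> x - q x))\<^sup>2 \<le> (\<integral>x. \<eta>\<^sup>2 \<partial>M)"
        unfolding Hnorm_power2
      proof (rule integral_mono_AE)
        show "integrable M (\<lambda>x. (\<phi> x - q x)\<^sup>2)"
          by (intro L2_integrable_power2 L2_diff \<phi> q_L2)
        \<comment> \<open>The half-open cells miss the right endpoint, which is a null set.\<close>
        have "AE x in lborel. x \<noteq> b" by (rule AE_lborel_singleton)
        then show "AE x in M. (\<phi> x - q x)\<^sup>2 \<le> \<eta>\<^sup>2"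
          unfolding M_def
        proof (subst AE_restrict_space_iff, simp, elim eventually_mono, intro impI)
          fix x assume "x \<noteq> b" "x \<in> {a..b}"
          then have "\<bar>\<phi> x - q x\<bar> \<le> \<eta>" by (intro close) auto
          then show "(\<phi> x - q x)\<^sup>2 \<le> \<eta>\<^sup>2" using power_mono[of "\<bar>\<phi> x - q x\<bar>" \<eta> 2] by simp
        qed
      qed simp
      also have "\<dots> = \<eta>\<^sup>2 * (b - a)"
        using ab by (simp add: M_def measure_restrict_space space_restrict_space)
      also have "\<dots> = (\<eta> * sqrt (b - a))\<^sup>2" using ab by (simp add: power_mult_distrib)
      also have "\<eta> * sqrt (b - a) = e / 2" using ab by (simp add: \<eta>_def)
      finally have "Hnorm M (\<lambda>x. \<phi> x - q x) \<le> e / 2"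
        by (rule power2_le_imp_le) (use e in simp)
      moreover have "Hnorm M (\<lambda>x. (f x - \<phi> x) + (\<phi> x - q x)) \<le> Hnorm M (\<lambda>x. f x - \<phi> x) + Hnorm M (\<lambda>x. \<phi> x - q x)"
        using f \<phi>(2) q_L2 by (intro Hnorm_triangle L2_diff)
      ultimately have "Hnorm M (\<lambda>x. f x - q x) < e" using \<phi>(3) by simp
      then show ?case
        unfolding q_def by (rule exI[where x = "\<lambda>j. \<phi> (a + real j * h n) * sqrt (h n)"])
    qed
  qed
  have "orthonormal_approximation M (\<lambda>n. {..n}) g"
    unfolding orthonormal_approximation_def using g_L2 g_on approx by simp
  then show ?thesis
    by (simp add: M_def g_def[abs_def] C_def)
qed

lemma admissible_base_orthonormal_approximation:
  assumes "admissible_base M"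
  obtains K :: "nat \<Rightarrow> nat set" and g where "orthonormal_approximation M K g"
  using assms unfolding admissible_base_def
proof (elim disjE exE conjE)
  fix a b :: real assume "a < b" "M = restrict_space lborel {a..b}"
  then show thesis using that orthonormal_approximation_interval by blast
next
  fix d :: nat assume "M = count_space (real ` {1..d})"
  then show thesis
    using that orthonormal_approximation_count_space[of "real ` {1..d}" real "{1..d}"] by simp
qed

section \<open>Concentration of the norm of weighted sums\<close>

lemma measurable_Hinner:
  assumes "g \<in> L2 L"
  shows "(\<lambda>f. Hinner L f g) \<in> borel_measurable (Hborel L)"
proof (rule measurableI)
  fix B :: "real set" assume "B \<in> sets borel"
  with assms have "(\<lambda>f. Hinner L f g) -` B \<in> {(\<lambda>f. Hinner L f g) -` B | g B. g \<in> L2 L \<and> B \<in> sets borel}"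
    by blast
  then show "(\<lambda>f. Hinner L f g) -` B \<inter> space (Hborel L) \<in> sets (Hborel L)"
    by (simp add: Hborel_def)
qed simp

text \<open>\<open>Hborel\<close> makes inner products with fixed functions measurable. The norm is
  reached as a limit of the norms of finite coordinate vectors, and the finite-dimensional cosh
  bound passes to this limit by dominated convergence.\<close>

lemma (in prob_space)
  fixes \<epsilon> :: "'i \<Rightarrow> 'a \<Rightarrow> 'b \<Rightarrow> real" and w c :: "'i \<Rightarrow> real"
  assumes oa: "orthonormal_approximation L K g" and I: "finite I"
    and L2: "\<And>i \<omega>. i \<in> I \<Longrightarrow> \<omega> \<in> space M \<Longrightarrow> \<epsilon> i \<omega> \<in> L2 L"
    and indep: "indep_vars (\<lambda>_. Hborel L) \<epsilon> I"
  shows borel_measurable_Hnorm_sum: "(\<lambda>\<omega>. Hnorm L (\<lambda>x. \<Sum>i\<in>I. w i * \<epsilon> i \<omega> x)) \<in> borel_measurable M"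
    and expectation_cosh_Hnorm_sum_le:
      "(\<And>i h. i \<in> I \<Longrightarrow> h \<in> L2 L \<Longrightarrow> expectation (\<lambda>\<omega>. Hinner L (\<epsilon> i \<omega>) h) = 0) \<Longrightarrow>
       (\<And>i. i \<in> I \<Longrightarrow> 0 \<le> c i) \<Longrightarrow>
       (\<And>i. i \<in> I \<Longrightarrow> AE \<omega> in M. Hnorm L (\<epsilon> i \<omega>) \<le> c i) \<Longrightarrow>
       expectation (\<lambda>\<omega>. cosh (Hnorm L (\<lambda>x. \<Sum>i\<in>I. w i * \<epsilon> i \<omega> x))) \<le> (\<Prod>i\<in>I. cosh (w i * c i))"
proof -
  define Z where "Z \<omega> x = (\<Sum>i\<in>I. w i * \<epsilon> i \<omega> x)" for \<omega> x
  \<comment> \<open>The coordinate vector is restricted to \<open>K n\<close> to be a point of the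
    product space.\<close>
  define X where "X n i \<omega> = (\<lambda>k\<in>K n. w i * Hinner L (\<epsilon> i \<omega>) (g n k))" for n i \<omega>
  have K: "finite (K n)" and g: "k \<in> K n \<Longrightarrow> g n k \<in> L2 L"
    and on: "k \<in> K n \<Longrightarrow> l \<in> K n \<Longrightarrow> Hinner L (g n k) (g n l) = (if k = l then 1 else 0)" for n k l
    using oa by (auto simp: orthonormal_approximation_def)
  have Z: "Z \<omega> \<in> L2 L" if "\<omega> \<in> space M" for \<omega>
    unfolding Z_def[abs_def] using L2 that by (intro L2_sum L2_cmult)
  have sum_X: "(\<Sum>i\<in>I. X n i \<omega> k) = Hinner L (Z \<omega>) (g n k)" if "\<omega> \<in> space M" "k \<in> K n" for n \<omega> k
    unfolding Z_def[abs_def] using that L2 g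
    by (subst Hinner_sum_left) (auto simp: X_def L2_cmult Hinner_cmult_left)
  have norm_X: "L2_set (\<lambda>k. \<Sum>i\<in>I. X n i \<omega> k) (K n) = L2_set (\<lambda>k. Hinner L (Z \<omega>) (g n k)) (K n)"
    if "\<omega> \<in> space M" for n \<omega>
    using that by (intro L2_set_cong) (auto simp: sum_X)
  have indep_X: "indep_vars (\<lambda>_. PiM (K n) (\<lambda>_. borel)) (X n) I" for n
    unfolding X_def
    by (rule indep_vars_compose2[OF indep])
       (intro measurable_restrict borel_measurable_times borel_measurable_const measurable_Hinner g)
  have X_rv: "random_variable (PiM (K n) (\<lambda>_. borel)) (X n i)" if "i \<in> I" for n i
    using indep_X[of n] that unfolding indep_vars_def by blast
  have [measurable]: "(\<lambda>\<omega>. X n i \<omega> k) \<in> borel_measurable M" if "i \<in> I" "k \<in> K n" for n i k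
    by (rule measurable_compose[OF X_rv[OF that(1)] measurable_component_singleton[OF that(2)]])
  have meas_n [measurable]: "(\<lambda>\<omega>. L2_set (\<lambda>k. \<Sum>i\<in>I. X n i \<omega> k) (K n)) \<in> borel_measurable M" for n
    by measurable
  have lim: "(\<lambda>n. L2_set (\<lambda>k. \<Sum>i\<in>I. X n i \<omega> k) (K n)) \<longlonglongrightarrow> Hnorm L (Z \<omega>)" if "\<omega> \<in> space M" for \<omega>
    unfolding norm_X[OF that] by (rule orthonormal_approximation_tendsto[OF oa Z[OF that]])
  have meas: "(\<lambda>\<omega>. Hnorm L (Z \<omega>)) \<in> borel_measurable M"
    by (rule borel_measurable_LIMSEQ_real[OF lim meas_n])
  then show "(\<lambda>\<omega>. Hnorm L (\<lambda>x. \<Sum>i\<in>I. w i * \<epsilon> i \<omega> x)) \<in> borel_measurable M"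
    by (simp add: Z_def[abs_def])
  assume mean: "\<And>i h. i \<in> I \<Longrightarrow> h \<in> L2 L \<Longrightarrow> expectation (\<lambda>\<omega>. Hinner L (\<epsilon> i \<omega>) h) = 0"
    and c: "\<And>i. i \<in> I \<Longrightarrow> 0 \<le> c i"
    and bdd: "\<And>i. i \<in> I \<Longrightarrow> AE \<omega> in M. Hnorm L (\<epsilon> i \<omega>) \<le> c i"
  define B where "B = (\<Sum>i\<in>I. \<bar>w i\<bar> * c i)"
  have B0: "0 \<le> B" using c by (auto simp: B_def intro!: sum_nonneg)
  \<comment> \<open>The finite-dimensional bound asks for nonnegative constants, hence \<bar>w
    i\<bar>; cosh is even, so the absolute value disappears at the end.\<close>
  have bound_n: "expectation (\<lambda>\<omega>. cosh (L2_set (\<lambda>k. \<Sum>i\<in>I. X n i \<omega> k) (K n))) \<le> (\<Prod>i\<in>I. cosh (\<bar>w i\<bar> * c i))" for n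
  proof (rule expectation_cosh_norm_sum_le[OF I K indep_X])
    show "expectation (\<lambda>\<omega>. X n i \<omega> k) = 0" if "i \<in> I" "k \<in> K n" for i k
      using that mean[OF that(1) g[OF that(2)]] by (simp add: X_def)
    show "0 \<le> \<bar>w i\<bar> * c i" if "i \<in> I" for i using c[OF that] by simp
    show "AE \<omega> in M. L2_set (X n i \<omega>) (K n) \<le> \<bar>w i\<bar> * c i" if i: "i \<in> I" for i
      using bdd[OF i] AE_space
    proof eventually_elim
      case (elim \<omega>)
      have "L2_set (X n i \<omega>) (K n) = L2_set (\<lambda>k. Hinner L (\<lambda>x. w i * \<epsilon> i \<omega> x) (g n k)) (K n)"
        by (rule L2_set_cong) (auto simp: X_def Hinner_cmult_left)
      also have "\<dots> \<le> Hnorm L (\<lambda>x. w i * \<epsilon> i \<omega> x)"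
        using L2[OF i elim(2)] K g on by (intro Bessel_inequality L2_cmult)
      also have "\<dots> \<le> \<bar>w i\<bar> * c i"
        using elim(1) by (simp add: Hnorm_cmult mult_left_mono)
      finally show ?case .
    qed
  qed
  have "(\<lambda>n. expectation (\<lambda>\<omega>. cosh (L2_set (\<lambda>k. \<Sum>i\<in>I. X n i \<omega> k) (K n)))) \<longlonglongrightarrow>
      expectation (\<lambda>\<omega>. cosh (Hnorm L (Z \<omega>)))"
  proof (rule integral_dominated_convergence[where w = "\<lambda>_. cosh B"])
    show "AE \<omega> in M. (\<lambda>n. cosh (L2_set (\<lambda>k. \<Sum>i\<in>I. X n i \<omega> k) (K n))) \<longlonglongrightarrow> cosh (Hnorm L (Z \<omega>))"
      by (intro AE_I2 tendsto_cosh lim)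
    have "AE \<omega> in M. \<forall>i\<in>I. Hnorm L (\<epsilon> i \<omega>) \<le> c i"
      using I bdd by (intro AE_finite_allI)
    then show "AE \<omega> in M. norm (cosh (L2_set (\<lambda>k. \<Sum>i\<in>I. X n i \<omega> k) (K n))) \<le> cosh B" for n
      using AE_space
    proof eventually_elim
      case (elim \<omega>)
      have "L2_set (\<lambda>k. \<Sum>i\<in>I. X n i \<omega> k) (K n) \<le> Hnorm L (Z \<omega>)"
        unfolding norm_X[OF elim(2)] using Z[OF elim(2)] K g on by (intro Bessel_inequality)
      also have "\<dots> \<le> (\<Sum>i\<in>I. Hnorm L (\<lambda>x. w i * \<epsilon> i \<omega> x))"
        unfolding Z_def[abs_def] using L2 elim(2) by (intro Hnorm_sum_le L2_cmult)
      also have "\<dots> \<le> B"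
        unfolding B_def using elim(1) by (intro sum_mono) (simp add: Hnorm_cmult mult_left_mono)
      finally show ?case using B0 by (simp add: cosh_real_nonneg_le_iff)
    qed
  qed (use meas in measurable)
  then have "expectation (\<lambda>\<omega>. cosh (Hnorm L (Z \<omega>))) \<le> (\<Prod>i\<in>I. cosh (\<bar>w i\<bar> * c i))"
    using bound_n by (intro LIMSEQ_le_const2) auto
  also have "\<dots> = (\<Prod>i\<in>I. cosh (w i * c i))"
    by (intro prod.cong refl) (simp add: abs_if)
  finally show "expectation (\<lambda>\<omega>. cosh (Hnorm L (\<lambda>x. \<Sum>i\<in>I. w i * \<epsilon> i \<omega> x))) \<le> (\<Prod>i\<in>I. cosh (w i * c i))"
    by (simp add: Z_def[abs_def])
qed

text \<open>Markov's inequality for cosh (t * Z) with t = \<delta> / V, the minimizer of t^2 * V^2 /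
  2 - t * \<delta> * V. The expectation is at most exp (\<delta>^2 / 2), and the threshold is cosh
  (\<delta>^2).\<close>

lemma (in prob_space) Hnorm_sum_concentration:
  fixes \<epsilon> :: "'i \<Rightarrow> 'a \<Rightarrow> 'b \<Rightarrow> real" and w c :: "'i \<Rightarrow> real"
  assumes oa: "orthonormal_approximation L K g" and I: "finite I"
    and L2: "\<And>i \<omega>. i \<in> I \<Longrightarrow> \<omega> \<in> space M \<Longrightarrow> \<epsilon> i \<omega> \<in> L2 L"
    and indep: "indep_vars (\<lambda>_. Hborel L) \<epsilon> I"
    and mean: "\<And>i h. i \<in> I \<Longrightarrow> h \<in> L2 L \<Longrightarrow> expectation (\<lambda>\<omega>. Hinner L (\<epsilon> i \<omega>) h) = 0"
    and c: "\<And>i. i \<in> I \<Longrightarrow> 0 \<le> c i"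
    and bdd: "\<And>i. i \<in> I \<Longrightarrow> AE \<omega> in M. Hnorm L (\<epsilon> i \<omega>) \<le> c i"
    and V: "0 < V" "(\<Sum>i\<in>I. (w i * c i)\<^sup>2) \<le> V\<^sup>2" and \<delta>: "0 < \<delta>"
  shows "prob {\<omega> \<in> space M. Hnorm L (\<lambda>x. \<Sum>i\<in>I. w i * \<epsilon> i \<omega> x) \<le> \<delta> * V} \<ge> 1 - 2 * exp (- (\<delta>\<^sup>2) / 2)"
proof -
  define Z where "Z \<omega> = Hnorm L (\<lambda>x. \<Sum>i\<in>I. w i * \<epsilon> i \<omega> x)" for \<omega>
  define t where "t = \<delta> / V"
  have t: "0 < t" using \<delta> V by (simp add: t_def)
  have Z_meas [measurable]: "Z \<in> borel_measurable M"
    unfolding Z_def by (rule borel_measurable_Hnorm_sum[OF oa I L2 indep])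
  \<comment> \<open>The scale \<open>t\<close> is absorbed into the weights, so the cosh bound
    applies as it stands.\<close>
  have tZ: "Hnorm L (\<lambda>x. \<Sum>i\<in>I. t * w i * \<epsilon> i \<omega> x) = t * Z \<omega>" for \<omega>
    using t Hnorm_cmult[of L t "\<lambda>x. \<Sum>i\<in>I. w i * \<epsilon> i \<omega> x"]
    by (simp add: Z_def sum_distrib_left mult.assoc)
  have "expectation (\<lambda>\<omega>. cosh (t * Z \<omega>)) \<le> (\<Prod>i\<in>I. cosh (t * w i * c i))"
    using expectation_cosh_Hnorm_sum_le[OF oa I L2 indep mean c bdd, of "\<lambda>i. t * w i"] by (simp add: tZ)
  also have "\<dots> \<le> (\<Prod>i\<in>I. exp ((t * w i * c i)\<^sup>2 / 2))"
    by (intro prod_mono conjI cosh_le_exp_half_square) auto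
  also have "\<dots> = exp (t\<^sup>2 / 2 * (\<Sum>i\<in>I. (w i * c i)\<^sup>2))"
    using I by (simp add: exp_sum sum_distrib_left power_mult_distrib mult_ac)
  also have "\<dots> \<le> exp (t\<^sup>2 / 2 * V\<^sup>2)"
    using V by (simp add: mult_left_mono)
  also have "t\<^sup>2 / 2 * V\<^sup>2 = \<delta>\<^sup>2 / 2"
    using V by (simp add: t_def power_divide)
  finally have E: "expectation (\<lambda>\<omega>. cosh (t * Z \<omega>)) \<le> exp (\<delta>\<^sup>2 / 2)" .
  have int: "integrable M (\<lambda>\<omega>. cosh (t * Z \<omega>))"
  proof (rule integrable_const_bound[where B = "cosh (t * (\<Sum>i\<in>I. \<bar>w i\<bar> * c i))"])
    have "AE \<omega> in M. \<forall>i\<in>I. Hnorm L (\<epsilon> i \<omega>) \<le> c i"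
      using I bdd by (intro AE_finite_allI)
    then show "AE \<omega> in M. norm (cosh (t * Z \<omega>)) \<le> cosh (t * (\<Sum>i\<in>I. \<bar>w i\<bar> * c i))"
      using AE_space
    proof eventually_elim
      case (elim \<omega>)
      have "Z \<omega> \<le> (\<Sum>i\<in>I. Hnorm L (\<lambda>x. w i * \<epsilon> i \<omega> x))"
        unfolding Z_def using L2 elim(2) by (intro Hnorm_sum_le L2_cmult)
      also have "\<dots> \<le> (\<Sum>i\<in>I. \<bar>w i\<bar> * c i)"
        using elim(1) by (intro sum_mono) (simp add: Hnorm_cmult mult_left_mono)
      finally have "t * Z \<omega> \<le> t * (\<Sum>i\<in>I. \<bar>w i\<bar> * c i)" using t by simp
      moreover have "0 \<le> t * Z \<omega>" using t by (simp add: Z_def)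
      ultimately show ?case by (simp add: cosh_real_nonneg_le_iff)
    qed
  qed measurable
  have "prob {\<omega> \<in> space M. \<delta> * V < Z \<omega>} \<le> prob {\<omega> \<in> space M. cosh (t * Z \<omega>) \<ge> cosh (\<delta>\<^sup>2)}"
  proof (rule finite_measure_mono)
    show "{\<omega> \<in> space M. \<delta> * V < Z \<omega>} \<subseteq> {\<omega> \<in> space M. cosh (t * Z \<omega>) \<ge> cosh (\<delta>\<^sup>2)}"
    proof safe
      fix \<omega> assume "\<delta> * V < Z \<omega>"
      then have "t * (\<delta> * V) \<le> t * Z \<omega>" using t by simp
      moreover have "t * (\<delta> * V) = \<delta>\<^sup>2" using V by (simp add: t_def power2_eq_square)
      moreover have "0 \<le> t * Z \<omega>" using t by (simp add: Z_def)
      ultimately show "cosh (\<delta>\<^sup>2) \<le> cosh (t * Z \<omega>)" by (simp add: cosh_real_nonneg_le_iff)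
    qed
  qed measurable
  also have "\<dots> \<le> expectation (\<lambda>\<omega>. cosh (t * Z \<omega>)) / cosh (\<delta>\<^sup>2)"
    by (rule integral_Markov_inequality_measure[OF int, where A = "{}"]) auto
  \<comment> \<open>The factor 2 of the tail bound comes from cosh y \<ge> exp y / 2.\<close>
  also have "\<dots> \<le> exp (\<delta>\<^sup>2 / 2) / (exp (\<delta>\<^sup>2) / 2)"
    using E by (intro frac_le) (auto simp: cosh_field_def)
  also have "\<dots> = 2 * exp (\<delta>\<^sup>2 / 2 - \<delta>\<^sup>2)"
    unfolding exp_diff by simp
  also have "\<delta>\<^sup>2 / 2 - \<delta>\<^sup>2 = - (\<delta>\<^sup>2) / 2" by simp
  finally have "prob {\<omega> \<in> space M. \<delta> * V < Z \<omega>} \<le> 2 * exp (- (\<delta>\<^sup>2) / 2)" .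
  moreover have "prob {\<omega> \<in> space M. \<not> \<delta> * V < Z \<omega>} = 1 - prob {\<omega> \<in> space M. \<delta> * V < Z \<omega>}"
    by (rule prob_neg) measurable
  ultimately show ?thesis by (simp add: Z_def not_less)
qed

section \<open>Hilbert--Schmidt kernels\<close>

text \<open>Fubini's theorem yields square-integrable sections for almost every x only, so later
  pointwise arguments with kernels hold almost everywhere.\<close>

lemma L2_kernel_AE_section_L2:
  assumes "sigma_finite_measure M" "L2_kernel M \<beta>"
  shows "AE x in M. \<beta> x \<in> L2 M"
proof -
  interpret sigma_finite_measure M by fact
  interpret pair_sigma_finite M M ..
  have int: "integrable (M \<Otimes>\<^sub>M M) (\<lambda>z. (\<beta> (fst z) (snd z))\<^sup>2)"
    and meas: "(\<lambda>z. \<beta> (fst z) (snd z)) \<in> borel_measurable (M \<Otimes>\<^sub>M M)"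
    using assms(2) by (auto simp: L2_kernel_def)
  show ?thesis
    using AE_integrable_fst'[OF int] AE_space
  proof eventually_elim
    case (elim x)
    then show ?case
      using measurable_compose[OF measurable_Pair1'[OF elim(2), of M] meas] by (simp add: L2_def)
  qed
qed

text \<open>For almost every x, Cauchy--Schwarz in y and then over t bounds the square of the sum by
  \<open>G x * C\<close>. Integrating \<open>G\<close> gives the squared Hilbert--Schmidt norms by
  Fubini. Membership in \<open>L2\<close> and the norm bound both come from this majorant.\<close>

lemma
  assumes sf: "sigma_finite_measure M" and S: "finite S"
    and \<beta>: "\<And>t. t \<in> S \<Longrightarrow> L2_kernel M (\<beta> t)" and D: "\<And>t. t \<in> S \<Longrightarrow> D t \<in> L2 M"
  shows sum_kernel_L2: "(\<lambda>x. \<Sum>t\<in>S. \<integral>y. \<beta> t x y * D t y \<partial>M) \<in> L2 M"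
    and Hnorm_sum_kernel_le: "Hnorm M (\<lambda>x. \<Sum>t\<in>S. \<integral>y. \<beta> t x y * D t y \<partial>M) \<le>
      sqrt (\<Sum>t\<in>S. (HSnorm M (\<beta> t))\<^sup>2) * sqrt (\<Sum>t\<in>S. (Hnorm M (D t))\<^sup>2)"
proof -
  interpret sigma_finite_measure M by fact
  interpret pair_sigma_finite M M ..
  define b where "b x = (\<Sum>t\<in>S. \<integral>y. \<beta> t x y * D t y \<partial>M)" for x
  define C where "C = (\<Sum>t\<in>S. (Hnorm M (D t))\<^sup>2)"
  define G where "G x = (\<Sum>t\<in>S. (Hnorm M (\<beta> t x))\<^sup>2)" for x
  have C: "0 \<le> C" by (simp add: C_def sum_nonneg)
  have int: "integrable (M \<Otimes>\<^sub>M M) (\<lambda>z. (\<beta> t (fst z) (snd z))\<^sup>2)"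
    and meas: "(\<lambda>z. \<beta> t (fst z) (snd z)) \<in> borel_measurable (M \<Otimes>\<^sub>M M)" if "t \<in> S" for t
    using \<beta>[OF that] by (auto simp: L2_kernel_def)
  have "(\<lambda>x. \<integral>y. \<beta> t x y * D t y \<partial>M) \<in> borel_measurable M" if t: "t \<in> S" for t
  proof -
    have "(\<lambda>z. \<beta> t (fst z) (snd z) * D t (snd z)) \<in> borel_measurable (M \<Otimes>\<^sub>M M)"
      using meas[OF t] L2_measurable[OF D[OF t]] by measurable
    then have "(\<lambda>(x, y). \<beta> t x y * D t y) \<in> borel_measurable (M \<Otimes>\<^sub>M M)"
      by (simp add: case_prod_beta')
    from sigma_finite_measure.borel_measurable_lebesgue_integral[OF sf this] show ?thesis .
  qed
  then have b_meas: "b \<in> borel_measurable M" unfolding b_def[abs_def] by measurable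
  have G_int: "integrable M G" and G_eq: "(\<integral>x. G x \<partial>M) = (\<Sum>t\<in>S. (HSnorm M (\<beta> t))\<^sup>2)"
  proof -
    have 1: "integrable M (\<lambda>x. (Hnorm M (\<beta> t x))\<^sup>2)" if "t \<in> S" for t
      using integrable_fst'[OF int[OF that]] by (simp add: Hnorm_power2)
    then show "integrable M G" unfolding G_def[abs_def] by simp
    have 2: "(\<integral>x. (Hnorm M (\<beta> t x))\<^sup>2 \<partial>M) = (HSnorm M (\<beta> t))\<^sup>2" if "t \<in> S" for t
      using integral_fst'[OF int[OF that]] by (simp add: Hnorm_power2 HSnorm_def)
    show "(\<integral>x. G x \<partial>M) = (\<Sum>t\<in>S. (HSnorm M (\<beta> t))\<^sup>2)"
      unfolding G_def[abs_def] using 1 2 by (simp add: Bochner_Integration.integral_sum)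
  qed
  have "AE x in M. \<forall>t\<in>S. \<beta> t x \<in> L2 M"
    using S L2_kernel_AE_section_L2[OF sf \<beta>] by (intro AE_finite_allI)
  then have b_le: "AE x in M. (b x)\<^sup>2 \<le> G x * C"
  proof eventually_elim
    case (elim x)
    have "\<bar>b x\<bar> \<le> (\<Sum>t\<in>S. \<bar>Hnorm M (\<beta> t x)\<bar> * \<bar>Hnorm M (D t)\<bar>)"
      unfolding b_def
    proof (rule order_trans[OF sum_abs sum_mono])
      fix t assume "t \<in> S"
      then show "\<bar>\<integral>y. \<beta> t x y * D t y \<partial>M\<bar> \<le> \<bar>Hnorm M (\<beta> t x)\<bar> * \<bar>Hnorm M (D t)\<bar>"
        using Hinner_Cauchy_Schwarz[of "\<beta> t x" M "D t"] elim D by (simp add: Hinner_def)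
    qed
    also have "\<dots> \<le> L2_set (\<lambda>t. Hnorm M (\<beta> t x)) S * L2_set (\<lambda>t. Hnorm M (D t)) S"
      by (rule L2_set_mult_ineq)
    finally have "\<bar>b x\<bar>\<^sup>2 \<le> (L2_set (\<lambda>t. Hnorm M (\<beta> t x)) S * L2_set (\<lambda>t. Hnorm M (D t)) S)\<^sup>2"
      by (intro power_mono) auto
    then show ?case by (simp add: power_mult_distrib L2_set_power2 G_def C_def)
  qed
  have GC_int: "integrable M (\<lambda>x. G x * C)" using G_int by simp
  have b_int: "integrable M (\<lambda>x. (b x)\<^sup>2)"
  proof (rule Bochner_Integration.integrable_bound[OF GC_int])
    show "AE x in M. norm ((b x)\<^sup>2) \<le> norm (G x * C)"
      using b_le by eventually_elim (simp add: order_trans[OF _ abs_ge_self])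
  qed (use b_meas in measurable)
  then show "(\<lambda>x. \<Sum>t\<in>S. \<integral>y. \<beta> t x y * D t y \<partial>M) \<in> L2 M"
    using b_meas by (simp add: L2_def b_def[abs_def])
  have "(Hnorm M b)\<^sup>2 \<le> (\<integral>x. G x * C \<partial>M)"
    unfolding Hnorm_power2 by (rule integral_mono_AE[OF b_int GC_int b_le])
  also have "\<dots> = (\<Sum>t\<in>S. (HSnorm M (\<beta> t))\<^sup>2) * C"
    using G_eq by simp
  finally have "Hnorm M b \<le> sqrt ((\<Sum>t\<in>S. (HSnorm M (\<beta> t))\<^sup>2) * C)"
    by (rule real_le_rsqrt)
  then show "Hnorm M (\<lambda>x. \<Sum>t\<in>S. \<integral>y. \<beta> t x y * D t y \<partial>M) \<le>
      sqrt (\<Sum>t\<in>S. (HSnorm M (\<beta> t))\<^sup>2) * sqrt (\<Sum>t\<in>S. (Hnorm M (D t))\<^sup>2)"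
    by (simp add: b_def[abs_def] C_def real_sqrt_mult)
qed

lemma admissible_base_sigma_finite:
  assumes "admissible_base M"
  shows "sigma_finite_measure M"
  using assms unfolding admissible_base_def
proof (elim disjE exE conjE)
  fix a b :: real assume "M = restrict_space lborel {a..b}"
  then show ?thesis
    using finite_measure_restrict_lborel finite_measure.sigma_finite_measure by blast
next
  fix d :: nat assume "M = count_space (real ` {1..d})"
  then show ?thesis
    by (simp add: sigma_finite_measure_count_space_finite)
qed

section \<open>The error bound\<close>

theorem theorem1:
  fixes M :: "real measure"
    and \<Psi> :: "'m::metric_space \<Rightarrow> real \<Rightarrow> real"
    and P :: "'w measure"
    and N T\<^sub>0 :: nat
    and \<beta> :: "nat \<Rightarrow> real \<Rightarrow> real \<Rightarrow> real"
    and Y :: "nat \<Rightarrow> nat \<Rightarrow> real \<Rightarrow> real"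
    and YNT :: "nat \<Rightarrow> 'w \<Rightarrow> real \<Rightarrow> real"
    and \<epsilon> :: "nat \<Rightarrow> 'w \<Rightarrow> real \<Rightarrow> real"
    and \<gamma> :: "nat \<Rightarrow> real"
    and \<sigma> \<delta> :: real
  assumes base: "admissible_base M"
    and Psi_L2: "range \<Psi> \<subseteq> L2 M"
    and Psi_isometry: "\<forall>a b. dist a b = Hnorm M (\<lambda>x. \<Psi> a x - \<Psi> b x)"
    and Y_closed: "H_closed M (range \<Psi>)"
    and Y_convex: "H_convex M (range \<Psi>)"
    and T0: "1 \<le> T\<^sub>0"
    and prob: "prob_space P"
    and beta: "\<forall>t\<in>{1..T\<^sub>0}. L2_kernel M (\<beta> t)"
    and Y_pre: "\<forall>i\<in>{1..N}. \<forall>t\<in>{1..T\<^sub>0}. Y i t \<in> range \<Psi>"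
    and YNT_in: "\<forall>i\<in>{1..N}. \<forall>\<omega>\<in>space P. YNT i \<omega> \<in> range \<Psi>"
    and AR: "\<forall>i\<in>{1..N}. \<forall>\<omega>\<in>space P. AE x in M.
               YNT i \<omega> x = (\<Sum>t=1..T\<^sub>0. \<integral>y. \<beta> t x y * Y i t y \<partial>M) + \<epsilon> i \<omega> x"
    and eps_L2: "\<forall>i\<in>{1..N}. \<forall>\<omega>\<in>space P. \<epsilon> i \<omega> \<in> L2 M"
    and eps_meas: "\<forall>i\<in>{1..N}. \<epsilon> i \<in> measurable P (Hborel M)"
    and eps_indep: "prob_space.indep_vars P (\<lambda>_. Hborel M) \<epsilon> {1..N}"
    and eps_mean0: "\<forall>i\<in>{1..N}. \<forall>g\<in>L2 M.
                      prob_space.expectation P (\<lambda>\<omega>. Hinner M (\<epsilon> i \<omega>) g) = 0"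
    and eps_bdd: "\<forall>i\<in>{1..N}. AE \<omega> in P. Hnorm M (\<epsilon> i \<omega>) \<le> \<sigma>"
    and sigma_pos: "0 < \<sigma>"
    and gamma_sum: "(\<Sum>i=2..N. \<gamma> i) = 1"
    and delta_pos: "0 < \<delta>"
  shows "\<exists>A\<in>sets P. measure P A \<ge> 1 - 2 * exp (- (\<delta>\<^sup>2) / 2) \<and>
    (\<forall>\<omega>\<in>A. \<forall>\<nu> \<nu>hat.
        \<Psi> \<nu> = YNT 1 \<omega> \<longrightarrow>
        (\<forall>z\<in>range \<Psi>. Hnorm M (\<lambda>x. \<Psi> \<nu>hat x - (\<Sum>i=2..N. \<gamma> i * YNT i \<omega> x))
                       \<le> Hnorm M (\<lambda>x. z x - (\<Sum>i=2..N. \<gamma> i * YNT i \<omega> x))) \<longrightarrow>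
        dist \<nu> \<nu>hat \<le>
          sqrt (\<Sum>t=1..T\<^sub>0. (HSnorm M (\<beta> t))\<^sup>2)
          * sqrt (\<Sum>t=1..T\<^sub>0. (Hnorm M (\<lambda>x. Y 1 t x - (\<Sum>i=2..N. \<gamma> i * Y i t x)))\<^sup>2)
          + \<delta> * \<sigma> * (1 + sqrt (\<Sum>i=2..N. (\<gamma> i)\<^sup>2)))"
proof -
  interpret P: prob_space P by (rule prob)
  note sf = admissible_base_sigma_finite[OF base]
  obtain K :: "nat \<Rightarrow> nat set" and g where oa: "orthonormal_approximation M K g"
    using admissible_base_orthonormal_approximation[OF base] .
  \<comment> \<open>Otherwise the weights would have the empty sum 0.\<close>
  have "N \<ge> 2" using gamma_sum by (cases "N \<ge> 2") auto
  then have N: "{1..N} = insert 1 {2..N}" by auto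
  \<comment> \<open>Weight 1 for the treated unit and - \<gamma> i for the controls turn every
    discrepancy into one weighted sum over all units.\<close>
  define w where "w i = (if i = 1 then 1 else - \<gamma> i)" for i :: nat
  have sum_w: "(\<Sum>i=1..N. w i * F i) = F 1 - (\<Sum>i=2..N. \<gamma> i * F i)" for F :: "nat \<Rightarrow> real"
  proof -
    have "(\<Sum>i=2..N. w i * F i) = (\<Sum>i=2..N. - (\<gamma> i * F i))"
      by (intro sum.cong) (auto simp: w_def)
    then show ?thesis unfolding N by (simp add: w_def sum_negf)
  qed
  define s where "s = sqrt (\<Sum>i=2..N. (\<gamma> i)\<^sup>2)"
  have s: "0 \<le> s" "s\<^sup>2 = (\<Sum>i=2..N. (\<gamma> i)\<^sup>2)" by (auto simp: s_def sum_nonneg)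
  define Z where "Z \<omega> x = (\<Sum>i=1..N. w i * \<epsilon> i \<omega> x)" for \<omega> x
  \<comment> \<open>The event restricts the noise alone; on it the remaining estimates are
    deterministic and hold for every \<open>\<nu>\<close> and \<open>\<nu>hat\<close>.\<close>
  define A where "A = {\<omega> \<in> space P. Hnorm M (Z \<omega>) \<le> \<delta> * (\<sigma> * (1 + s))}"
  have eps: "\<epsilon> i \<omega> \<in> L2 M" if "i \<in> {1..N}" "\<omega> \<in> space P" for i \<omega>
    using eps_L2 that by blast
  have Z_L2: "Z \<omega> \<in> L2 M" if "\<omega> \<in> space P" for \<omega>
    unfolding Z_def[abs_def] using eps that by (intro L2_sum L2_cmult)
  have "(\<lambda>\<omega>. Hnorm M (Z \<omega>)) \<in> borel_measurable P"
    unfolding Z_def by (rule P.borel_measurable_Hnorm_sum[OF oa _ eps eps_indep]) simp_all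
  then have A_sets: "A \<in> sets P" unfolding A_def by measurable
  \<comment> \<open>The squared weights sum to 1 + s^2 \<le> (1 + s)^2, which is the origin of the
    factor 1 + s in the bound.\<close>
  have "(\<Sum>i=2..N. (w i * \<sigma>)\<^sup>2) = (\<Sum>i=2..N. (\<gamma> i)\<^sup>2 * \<sigma>\<^sup>2)"
    by (intro sum.cong) (auto simp: w_def power_mult_distrib)
  then have "(\<Sum>i=1..N. (w i * \<sigma>)\<^sup>2) = \<sigma>\<^sup>2 * (1 + s\<^sup>2)"
    unfolding N by (simp add: w_def s(2) algebra_simps flip: sum_distrib_left)
  also have "\<dots> \<le> \<sigma>\<^sup>2 * (1 + s)\<^sup>2"
    using s(1) by (intro mult_left_mono) (auto simp: power2_sum)
  finally have V: "(\<Sum>i=1..N. (w i * \<sigma>)\<^sup>2) \<le> (\<sigma> * (1 + s))\<^sup>2" by (simp add: power_mult_distrib)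
  have "0 < \<sigma> * (1 + s)" using sigma_pos s(1) by simp
  then have "P.prob A \<ge> 1 - 2 * exp (- (\<delta>\<^sup>2) / 2)"
    unfolding A_def Z_def using eps eps_mean0 eps_bdd sigma_pos
    by (intro P.Hnorm_sum_concentration[OF oa _ _ eps_indep _ _ _ _ V delta_pos]) auto
  moreover have "dist \<nu> \<nu>hat \<le>
      sqrt (\<Sum>t=1..T\<^sub>0. (HSnorm M (\<beta> t))\<^sup>2)
      * sqrt (\<Sum>t=1..T\<^sub>0. (Hnorm M (\<lambda>x. Y 1 t x - (\<Sum>i=2..N. \<gamma> i * Y i t x)))\<^sup>2)
      + \<delta> * \<sigma> * (1 + s)"
    if \<omega>: "\<omega> \<in> A" and \<nu>: "\<Psi> \<nu> = YNT 1 \<omega>"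
      and min: "\<forall>z\<in>range \<Psi>. Hnorm M (\<lambda>x. \<Psi> \<nu>hat x - (\<Sum>i=2..N. \<gamma> i * YNT i \<omega> x))
        \<le> Hnorm M (\<lambda>x. z x - (\<Sum>i=2..N. \<gamma> i * YNT i \<omega> x))" for \<omega> \<nu> \<nu>hat
  proof -
    have sp: "\<omega> \<in> space P" using \<omega> by (simp add: A_def)
    define D where "D t x = Y 1 t x - (\<Sum>i=2..N. \<gamma> i * Y i t x)" for t x
    define b where "b x = (\<Sum>t=1..T\<^sub>0. \<integral>y. \<beta> t x y * D t y \<partial>M)" for x
    have Y_L2: "Y i t \<in> L2 M" if "i \<in> {1..N}" "t \<in> {1..T\<^sub>0}" for i t
      using Y_pre Psi_L2 that by blast
    have YNT_L2: "YNT i \<omega> \<in> L2 M" if "i \<in> {1..N}" for i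
      using YNT_in Psi_L2 that sp by blast
    have D_L2: "D t \<in> L2 M" if "t \<in> {1..T\<^sub>0}" for t
      unfolding D_def[abs_def] using Y_L2 that \<open>N \<ge> 2\<close> by (intro L2_diff L2_sum L2_cmult) auto
    have b_L2: "b \<in> L2 M"
      unfolding b_def[abs_def] using beta D_L2 by (intro sum_kernel_L2[OF sf]) auto
    have q_L2: "(\<lambda>x. \<Sum>i=2..N. \<gamma> i * YNT i \<omega> x) \<in> L2 M"
      using YNT_L2 by (intro L2_sum L2_cmult) auto
    have "dist \<nu> \<nu>hat = Hnorm M (\<lambda>x. YNT 1 \<omega> x - \<Psi> \<nu>hat x)"
      using Psi_isometry \<nu> by simp
    also have "\<dots> \<le> Hnorm M (\<lambda>x. YNT 1 \<omega> x - (\<Sum>i=2..N. \<gamma> i * YNT i \<omega> x))"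
      using min q_L2 \<nu>[symmetric] by (intro projection_nonexpansive[OF Psi_L2 Y_convex]) auto
    also have "\<dots> = Hnorm M (\<lambda>x. b x + Z \<omega> x)"
    proof (rule Hnorm_cong_AE)
      show "(\<lambda>x. YNT 1 \<omega> x - (\<Sum>i=2..N. \<gamma> i * YNT i \<omega> x)) \<in> borel_measurable M"
        using YNT_L2[of 1] q_L2 \<open>N \<ge> 2\<close> by (intro L2_measurable L2_diff) auto
      show "(\<lambda>x. b x + Z \<omega> x) \<in> borel_measurable M"
        using b_L2 Z_L2[OF sp] by (intro L2_measurable L2_add)
      have "AE x in M. \<forall>i\<in>{1..N}. YNT i \<omega> x = (\<Sum>t=1..T\<^sub>0. \<integral>y. \<beta> t x y * Y i t y \<partial>M) + \<epsilon> i \<omega> x"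
        using AR sp by (intro AE_finite_allI) auto
      \<comment> \<open>Linearity of the kernel integrals is used only at points x with
        square-integrable sections; elsewhere a non-integrable integrand would have the default
        integral 0.\<close>
      moreover have "AE x in M. \<forall>t\<in>{1..T\<^sub>0}. \<beta> t x \<in> L2 M"
        using L2_kernel_AE_section_L2[OF sf] beta by (intro AE_finite_allI) auto
      ultimately show "AE x in M. YNT 1 \<omega> x - (\<Sum>i=2..N. \<gamma> i * YNT i \<omega> x) = b x + Z \<omega> x"
      proof eventually_elim
        case (elim x)
        have lin: "(\<integral>y. \<beta> t x y * D t y \<partial>M) = (\<Sum>i=1..N. w i * (\<integral>y. \<beta> t x y * Y i t y \<partial>M))"
          if t: "t \<in> {1..T\<^sub>0}" for t
        proof -
          have "(\<integral>y. \<beta> t x y * D t y \<partial>M) = Hinner M (\<lambda>y. \<Sum>i=1..N. w i * Y i t y) (\<beta> t x)"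
            by (simp only: Hinner_def D_def sum_w mult.commute)
          also have "\<dots> = (\<Sum>i=1..N. w i * Hinner M (Y i t) (\<beta> t x))"
            using elim(2) t Y_L2 by (subst Hinner_sum_left) (auto simp: L2_cmult Hinner_cmult_left)
          finally show ?thesis by (simp add: Hinner_def mult.commute)
        qed
        have "b x = (\<Sum>t=1..T\<^sub>0. \<Sum>i=1..N. w i * (\<integral>y. \<beta> t x y * Y i t y \<partial>M))"
          unfolding b_def by (intro sum.cong refl lin)
        also have "\<dots> = (\<Sum>i=1..N. w i * (\<Sum>t=1..T\<^sub>0. \<integral>y. \<beta> t x y * Y i t y \<partial>M))"
          by (subst sum.swap) (simp add: sum_distrib_left)
        finally have "b x + Z \<omega> x = (\<Sum>i=1..N. w i * ((\<Sum>t=1..T\<^sub>0. \<integral>y. \<beta> t x y * Y i t y \<partial>M) + \<epsilon> i \<omega> x))"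
          by (simp add: Z_def distrib_left sum.distrib)
        also have "\<dots> = (\<Sum>i=1..N. w i * YNT i \<omega> x)"
          using elim(1) by (intro sum.cong) auto
        finally show ?case by (simp only: sum_w)
      qed
    qed
    also have "\<dots> \<le> Hnorm M b + Hnorm M (Z \<omega>)"
      using b_L2 Z_L2[OF sp] by (rule Hnorm_triangle)
    also have "Hnorm M b \<le> sqrt (\<Sum>t=1..T\<^sub>0. (HSnorm M (\<beta> t))\<^sup>2) * sqrt (\<Sum>t=1..T\<^sub>0. (Hnorm M (D t))\<^sup>2)"
      unfolding b_def[abs_def] using beta D_L2 by (intro Hnorm_sum_kernel_le[OF sf]) auto
    also have "Hnorm M (Z \<omega>) \<le> \<delta> * \<sigma> * (1 + s)"
      using \<omega> by (simp add: A_def mult.assoc)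
    finally show ?thesis by (simp add: D_def[abs_def])
  qed
  ultimately show ?thesis
    using A_sets unfolding s_def by blast
qed

end
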